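(* Let $I$ denote one of the intervals $(a,b)$, $(a,b]$, $[a,b)$, $[a,b]$, $(-\infty,b)$, $(-\infty,b]$, $(a,\infty)$, $[a,\infty)$ and $(-\infty,\infty)$, where $a<b$ are real numbers, except in statements (3), (4) and (5), where $I$ denotes one of $[a,b]$, $[a,\infty)$, $(-\infty,b]$, $(-\infty,\infty)$, and let $f:I\to I$ be a continuous map. Then the following statements are equivalent: (1) $f$ is transitive on $I$ and there exist a fixed point $z$ of $f$ and a point $c\ne z$ such that either $z<\min\{c,f(c)\}$ or $\max\{c,f(c)\}<z$, i.e., both points $c$ and $f(c)$ lie on the same side of $z$. (2) For any compact subinterval $K$ of $I$ and any compact subinterval $L$ of $\mathrm{int}(I)$, there exists a positive integer $M$ such that $f^n(K)\supset L$ for all $n\ge M$. (Consequently, for any positive integer $m$, any compact intervals $K_i$, $1\le i\le m$, and any intervals $V_i$, $1\le i\le m$, in $I$, by taking, for each $1\le i\le m$, a compact interval $L_i$ in the interior of $V_i$, there exists a positive integer $N_m$ such that $f^n(K_i)\supset L_i$ for all $1\le i\le m$ and all $n\ge N_m$, and so there exist compact intervals $K_{n,i}^*$ in $K_i$, $1\le i\le m$, such that $f^n(K_{n,i}^* )\subset L_i\subset V_i$ for all $1\le i\le m$ and all $n\ge N_m$. Since $f^n(K_{n,i}^* )$ is only required to be contained in $V_i$, the compact interval $K_{n,i}^*$ can be chosen as small as we wish.) (3) For any open interval $U$ in $I$, there exists a positive integer $m(U)$ such that $f$ has a period-$n$ point in $U$ for each integer $n\ge m(U)$, and $f$ has no proper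 invariant closed intervals in $I$. (4) For some infinite set $\mathcal N$ of positive integers which contains an odd integer $\ge 3$, the periodic points of $f$ with periods $n\in\mathcal N$ are dense in $I$, and $f$ has no proper invariant closed intervals in $I$. (5) The set of periodic points of $f$ is dense and $f^2$ has no proper invariant closed interval in $I$. (6) $f$ is (topologically) mixing, i.e., for any two nonempty open subsets $U$ and $V$ of $I$, there exists a positive integer $m(U,V)$ such that $f^n(U)\cap V\ne\emptyset$ for all $n\ge m(U,V)$. (7) $f$ is (topologically) weakly mixing, i.e., the map $f\times f$ defined by $(f\times f)((x,y))=(f(x),f(y))$ is transitive on $I\times I$. (8) For any infinite subset $\mathcal M$ of the positive integers, there is a residual set $S$ in $I$ such that $S$ is dense in $I$ and, if $x\in S$, then the set $\{f^n(x):n\in\mathcal M\}$ is dense in $I$. (9) $f^{2k}$ is transitive on $I$ for some positive integer $k$. (10) $f$ is totally transitive, i.e., $f^k$ is transitive on $I$ for each integer $k\ge 1$.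
   Context: All intervals are non-degenerate intervals in the real line; $\mathrm{int}(I)$ is the interior of $I$ with respect to the topology on the real line. $f^n$ is the $n$-th iterate of $f$. A continuous map $g$ of a space $X$ into itself is (topologically) transitive on $X$ if for any two nonempty open sets $U,V$ in $X$ there is a positive integer $k$ with $g^k(U)\cap V\ne\emptyset$. A period-$n$ point of $f$, or periodic point with least period $n$, is a point $x$ with $f^n(x)=x$ and $f^i(x)\ne x$ for $0<i<n$. A proper invariant closed interval of a map $g$ in $I$ is a closed interval $J\subsetneq I$ with $g(J)\subset J$. A residual set in $I$ is a set containing the intersection of countably infinitely many open dense sets.
   Formalization: In (4), every n in the set N is additionally required to be the least period of some periodic point of f; without this, N could contain an odd integer that is no period of f, and (4) would not imply (1). *)

theory Defs
  imports "HOL-Analysis.Analysis"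
begin

section \<open>Dynamical notions\<close>

definition dense_in :: "'a::topological_space set \<Rightarrow> 'a set \<Rightarrow> bool" where
  "dense_in X S \<longleftrightarrow> S \<subseteq> X \<and> X \<subseteq> closure S"

definition residual_in :: "'a::topological_space set \<Rightarrow> 'a set \<Rightarrow> bool" where
  "residual_in X S \<longleftrightarrow> S \<subseteq> X \<and>
     (\<exists>G :: nat \<Rightarrow> 'a set. (\<forall>n. openin (top_of_set X) (G n) \<and> dense_in X (G n)) \<and> (\<Inter>n. G n) \<subseteq> S)"

definition transitive_on :: "'a::topological_space set \<Rightarrow> ('a \<Rightarrow> 'a) \<Rightarrow> bool" where
  "transitive_on X g \<longleftrightarrow>
     (\<forall>U V. openin (top_of_set X) U \<and> U \<noteq> {} \<and> openin (top_of_set X) V \<and> V \<noteq> {} \<longrightarrow>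
        (\<exists>k>0. (g ^^ k) ` U \<inter> V \<noteq> {}))"

definition mixing_on :: "'a::topological_space set \<Rightarrow> ('a \<Rightarrow> 'a) \<Rightarrow> bool" where
  "mixing_on X g \<longleftrightarrow>
     (\<forall>U V. openin (top_of_set X) U \<and> U \<noteq> {} \<and> openin (top_of_set X) V \<and> V \<noteq> {} \<longrightarrow>
        (\<exists>m>0. \<forall>n\<ge>m. (g ^^ n) ` U \<inter> V \<noteq> {}))"

definition weakly_mixing_on :: "'a::topological_space set \<Rightarrow> ('a \<Rightarrow> 'a) \<Rightarrow> bool" where
  "weakly_mixing_on X g \<longleftrightarrow> transitive_on (X \<times> X) (map_prod g g)"

definition totally_transitive_on :: "'a::topological_space set \<Rightarrow> ('a \<Rightarrow> 'a) \<Rightarrow> bool" where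
  "totally_transitive_on X g \<longleftrightarrow> (\<forall>k\<ge>1. transitive_on X (g ^^ k))"

definition period_points :: "'a set \<Rightarrow> ('a \<Rightarrow> 'a) \<Rightarrow> nat \<Rightarrow> 'a set" where
  "period_points X g n =
     {x \<in> X. n > 0 \<and> (g ^^ n) x = x \<and> (\<forall>i. 0 < i \<and> i < n \<longrightarrow> (g ^^ i) x \<noteq> x)}"

definition nondeg_interval :: "real set \<Rightarrow> bool" where
  "nondeg_interval J \<longleftrightarrow> is_interval J \<and> (\<exists>x\<in>J. \<exists>y\<in>J. x < y)"

definition has_proper_invariant_closed_interval :: "real set \<Rightarrow> (real \<Rightarrow> real) \<Rightarrow> bool" where
  "has_proper_invariant_closed_interval I g \<longleftrightarrow>
     (\<exists>J. nondeg_interval J \<and> closed J \<and> J \<subset> I \<and> g ` J \<subseteq> J)"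


section \<open>The properties to be compared\<close>

definition transitive_with_same_side_point :: "real set \<Rightarrow> (real \<Rightarrow> real) \<Rightarrow> bool" where
  "transitive_with_same_side_point I f \<longleftrightarrow>
     transitive_on I f \<and>
     (\<exists>z\<in>I. f z = z \<and> (\<exists>c\<in>I. c \<noteq> z \<and> (z < min c (f c) \<or> max c (f c) < z)))"

definition eventually_covers_compact_intervals :: "real set \<Rightarrow> (real \<Rightarrow> real) \<Rightarrow> bool" where
  "eventually_covers_compact_intervals I f \<longleftrightarrow>
     (\<forall>K L. nondeg_interval K \<and> compact K \<and> K \<subseteq> I \<and>
            nondeg_interval L \<and> compact L \<and> L \<subseteq> interior I \<longrightarrow>
        (\<exists>M>0. \<forall>n\<ge>M. L \<subseteq> (f ^^ n) ` K))"

text \<open>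
  The simultaneous version for finitely many pairs. The number \<open>N\<close> does not depend on
  \<open>\<epsilon>\<close>, which expresses that the small intervals can be chosen as small as desired.
\<close>
definition simultaneous_covering :: "real set \<Rightarrow> (real \<Rightarrow> real) \<Rightarrow> bool" where
  "simultaneous_covering I f \<longleftrightarrow>
     (\<forall>(m::nat) K V L. m > 0 \<and>
        (\<forall>i\<in>{1..m}. nondeg_interval (K i) \<and> compact (K i) \<and> K i \<subseteq> I \<and>
                    nondeg_interval (V i) \<and> V i \<subseteq> I \<and>
                    nondeg_interval (L i) \<and> compact (L i) \<and> L i \<subseteq> interior (V i)) \<longrightarrow>
        (\<exists>N>0. \<forall>i\<in>{1..m}. \<forall>n\<ge>N.
           L i \<subseteq> (f ^^ n) ` K i \<and>
           (\<forall>\<epsilon>>0. \<exists>K'. nondeg_interval K' \<and> compact K' \<and> K' \<subseteq> K i \<and> diameter K' < \<epsilon> \<and>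
                     (f ^^ n) ` K' \<subseteq> L i)))"

definition all_large_periods_everywhere :: "real set \<Rightarrow> (real \<Rightarrow> real) \<Rightarrow> bool" where
  "all_large_periods_everywhere I f \<longleftrightarrow>
     (\<forall>U. nondeg_interval U \<and> open U \<and> U \<subseteq> I \<longrightarrow>
        (\<exists>m>0. \<forall>n\<ge>m. period_points I f n \<inter> U \<noteq> {})) \<and>
     \<not> has_proper_invariant_closed_interval I f"

text \<open>
  The numbers in \<open>N\<close> are required to be periods that really occur. Otherwise the
  odd number in \<open>N\<close> would say nothing about \<open>f\<close>: on \<open>[0,1]\<close>, the piecewise linear map with
  \<open>0 \<mapsto> 1/2\<close>, \<open>1/4 \<mapsto> 1\<close>, \<open>1/2 \<mapsto> 1/2\<close>, \<open>1 \<mapsto> 0\<close> is transitive but not mixing, has no proper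
  invariant closed interval, and its points of even period are dense.
\<close>
definition dense_periods_with_odd :: "real set \<Rightarrow> (real \<Rightarrow> real) \<Rightarrow> bool" where
  "dense_periods_with_odd I f \<longleftrightarrow>
     (\<exists>N :: nat set. infinite N \<and> N \<subseteq> {1..} \<and> (\<exists>q\<in>N. odd q \<and> q \<ge> 3) \<and>
        (\<forall>n\<in>N. period_points I f n \<noteq> {}) \<and>
        dense_in I (\<Union>n\<in>N. period_points I f n)) \<and>
     \<not> has_proper_invariant_closed_interval I f"

definition dense_periodic_square_irreducible :: "real set \<Rightarrow> (real \<Rightarrow> real) \<Rightarrow> bool" where
  "dense_periodic_square_irreducible I f \<longleftrightarrow>
     dense_in I (\<Union>n. period_points I f n) \<and>
     \<not> has_proper_invariant_closed_interval I (f ^^ 2)"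

definition residual_dense_along_every_subsequence :: "real set \<Rightarrow> (real \<Rightarrow> real) \<Rightarrow> bool" where
  "residual_dense_along_every_subsequence I f \<longleftrightarrow>
     (\<forall>M :: nat set. infinite M \<and> M \<subseteq> {1..} \<longrightarrow>
        (\<exists>S. residual_in I S \<and> dense_in I S \<and> (\<forall>x\<in>S. dense_in I {(f ^^ n) x |n. n \<in> M})))"

definition even_iterate_transitive :: "real set \<Rightarrow> (real \<Rightarrow> real) \<Rightarrow> bool" where
  "even_iterate_transitive I f \<longleftrightarrow> (\<exists>k>0. transitive_on I (f ^^ (2 * k)))"

end

theory Submission
  imports Defs
begin

text \<open>
  If \<open>f\<close> is transitive, every interval contains periodic points, since otherwise all returns to it
  would move points in the same direction. Hence every interval \<open>K\<close> contains some \<open>{p..q}\<close> with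
  \<open>f^n\<close> fixing \<open>p\<close> and \<open>q\<close>, the sets \<open>f^(i + n j) ` {p..q}\<close> increase in \<open>j\<close> to an interval \<open>J i\<close>, and
  \<open>f\<close> permutes the \<open>J i\<close> cyclically. The point \<open>c\<close> on the same side of \<open>z\<close> as \<open>f c\<close> forces all \<open>J i\<close>
  to share a one-sided neighbourhood of \<open>z\<close>. Their intersection is invariant, so every \<open>J i\<close> is dense,
  which gives the covering property (2), and (2) gives mixing and everything else. Conversely, a
  transitive map without such a \<open>c\<close> exchanges the two sides of an interior fixed point, which
  contradicts each of the other statements.

  Points of exact period \<open>n\<close> arise from closed itineraries of length \<open>n\<close> that start in \<open>K\<close> and visit
  an interval disjoint from \<open>K\<close> at some multiple of every proper divisor of \<open>n\<close>.
\<close>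

text \<open>Two obstacles shape the proof. A transitive map may exchange the two sides of a fixed
  point; if \<open>{p..q}\<close> then lies on one side, the sets \<open>J i\<close> alternate
  between the sides and none of them can be dense. The point \<open>c\<close> excludes this, but the
  fixed point that comes with it may be an endpoint of \<open>I\<close>, so it is first traded for
  an interior one. The second obstacle is the exact period. Covering makes \<open>f^n\<close> fix a
  point of \<open>K\<close> for every large \<open>n\<close>, but its least period may be a proper
  divisor of \<open>n\<close>. A visit to a disjoint interval at time \<open>d\<close> excludes the
  period \<open>d\<close>, yet covering starts only after some \<open>s\<close> steps, so scheduled
  visits must be \<open>s\<close> apart and cannot be placed at all divisors. A visit at a multiple
  of \<open>d\<close> is just as good, and this freedom leaves only the times \<open>n / j\<close>
  with \<open>j\<close> at most \<open>4 * s\<close>. Keeping those apart is what makes the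
  threshold for \<open>n\<close> cubic in \<open>s\<close>.\<close>

section \<open>Relatively open sets, density and transitivity tested on intervals\<close>

text \<open>Lets all shapes of intervals be treated at once: an endpoint that belongs to
  \<open>X\<close> is a limit of interior points, so it suffices to test inside the
  interior.\<close>

lemma nondeg_interval_closure_interior:
  assumes "nondeg_interval X"
  shows "closure (interior X) = closure X"
proof -
  obtain x y where xy: "x \<in> X" "y \<in> X" "x < y" and ivl: "is_interval X"
    using assms unfolding nondeg_interval_def by blast
  have "{x..y} \<subseteq> X"
    using ivl xy by (meson atLeastAtMost_iff mem_is_interval_1_I subsetI)
  then have "{x<..<y} \<subseteq> interior X"
    by (metis interior_atLeastAtMost_real interior_mono)
  then have "interior X \<noteq> {}"
    using xy(3) dense by fastforce
  then show ?thesis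
    using convex_closure_interior ivl is_interval_convex_1 by blast
qed

lemma open_real_contains_interval:
  assumes "open (U :: real set)" "x \<in> U"
  obtains a b where "a < x" "x < b" "{a..b} \<subseteq> U"
proof -
  obtain e where "e > 0" "cball x e \<subseteq> U"
    using assms open_contains_cball by blast
  then show ?thesis
    using that[of "x - e" "x + e"] by (simp add: cball_eq_atLeastAtMost)
qed

text \<open>A relatively open set need not be open in the line at an endpoint of \<open>X\<close>;
  density of the interior supplies a point of it away from the endpoints.\<close>

lemma openin_interval_contains_interval:
  assumes X: "nondeg_interval X" and U: "openin (top_of_set X) U" "U \<noteq> {}"
  obtains a b :: real where "a < b" "{a..b} \<subseteq> U" "{a..b} \<subseteq> interior X"
proof -
  obtain T where T: "open T" "U = X \<inter> T"
    using U(1) openin_open by blast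
  then obtain x where x: "x \<in> X" "x \<in> T"
    using U(2) by blast
  then have "x \<in> closure (interior X)"
    using nondeg_interval_closure_interior[OF X] closure_subset by blast
  then have "T \<inter> interior X \<noteq> {}"
    using x T(1) by (metis closure_iff_nhds_not_empty inf_commute subset_refl)
  then obtain y where "y \<in> T \<inter> interior X"
    by blast
  then obtain a b where "a < y" "y < b" "{a..b} \<subseteq> T \<inter> interior X"
    using open_real_contains_interval[of "T \<inter> interior X" y] T(1) by blast
  then show ?thesis
    using that[of a b] T(2) interior_subset by fastforce
qed

lemma dense_in_interval_iff:
  assumes X: "nondeg_interval X"
  shows "dense_in X S \<longleftrightarrow>
    S \<subseteq> X \<and> (\<forall>a b. a < b \<and> {a<..<b} \<subseteq> X \<longrightarrow> S \<inter> {a<..<b} \<noteq> {})" (is "_ \<longleftrightarrow> _ \<and> ?meets")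
proof -
  have "X \<subseteq> closure S \<longleftrightarrow> ?meets"
  proof
    assume cl: "X \<subseteq> closure S"
    show ?meets
    proof (intro allI impI)
      fix a b :: real assume "a < b \<and> {a<..<b} \<subseteq> X"
      then have "{a<..<b} \<inter> closure S \<noteq> {}"
        using cl dense[of a b] by fastforce
      then show "S \<inter> {a<..<b} \<noteq> {}"
        by (metis open_Int_closure_eq_empty open_greaterThanLessThan inf_commute)
    qed
  next
    assume meets: ?meets
    have "interior X \<subseteq> closure S"
    proof
      fix x assume x: "x \<in> interior X"
      have "T \<inter> S \<noteq> {}" if T: "open T" "x \<in> T" for T
      proof -
        obtain a b where ab: "a < x" "x < b" "{a..b} \<subseteq> T \<inter> interior X"
          using open_real_contains_interval[of "T \<inter> interior X" x] T x by blast
        then have "{a<..<b} \<subseteq> T" "{a<..<b} \<subseteq> X"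
          using interior_subset by (fastforce)+
        moreover have "a < b"
          using ab by simp
        ultimately show ?thesis
          using meets by blast
      qed
      then show "x \<in> closure S"
        unfolding closure_iff_nhds_not_empty by blast
    qed
    then show "X \<subseteq> closure S"
      using nondeg_interval_closure_interior[OF X]
      by (metis closure_minimal closed_closure closure_subset order_trans)
  qed
  then show ?thesis
    unfolding dense_in_def by blast
qed

lemma transitive_on_intervalE:
  assumes "transitive_on X g" "a < b" "{a<..<b} \<subseteq> X" "c < d" "{c<..<d} \<subseteq> X"
  obtains k x where "k > 0" "x \<in> {a<..<b}" "(g ^^ k) x \<in> {c<..<d::real}"
proof -
  have "openin (top_of_set X) {a<..<b}" "openin (top_of_set X) {c<..<d}"
    using assms by (auto intro: open_subset)
  moreover have "{a<..<b} \<noteq> {}" "{c<..<d} \<noteq> {}"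
    using assms by auto
  ultimately obtain k where "k > 0" "(g ^^ k) ` {a<..<b} \<inter> {c<..<d} \<noteq> {}"
    using assms(1)[unfolded transitive_on_def, rule_format, of "{a<..<b}" "{c<..<d}"] by metis
  then obtain x where "x \<in> {a<..<b}" "(g ^^ k) x \<in> {c<..<d}"
    by (auto simp del: greaterThanLessThan_iff)
  then show ?thesis
    using that \<open>k > 0\<close> by metis
qed

lemma transitive_on_intervalI:
  assumes X: "nondeg_interval X"
    and "\<And>a b c d. a < b \<Longrightarrow> {a..b} \<subseteq> interior X \<Longrightarrow> c < d \<Longrightarrow> {c..d} \<subseteq> interior X \<Longrightarrow>
      \<exists>k>0. \<exists>x\<in>{a..b}. (g ^^ k) x \<in> {c..d::real}"
  shows "transitive_on X g"
  unfolding transitive_on_def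
proof (intro allI impI)
  fix U V
  assume UV: "openin (top_of_set X) U \<and> U \<noteq> {} \<and> openin (top_of_set X) V \<and> V \<noteq> {}"
  obtain a b where ab: "a < b" "{a..b} \<subseteq> U" "{a..b} \<subseteq> interior X"
    using openin_interval_contains_interval[OF X] UV by metis
  obtain c d where cd: "c < d" "{c..d} \<subseteq> V" "{c..d} \<subseteq> interior X"
    using openin_interval_contains_interval[OF X] UV by metis
  obtain k x where "k > 0" "x \<in> {a..b}" "(g ^^ k) x \<in> {c..d}"
    using assms(2) ab cd by meson
  then show "\<exists>k>0. (g ^^ k) ` U \<inter> V \<noteq> {}"
    using ab cd by blast
qed

section \<open>Iterates at periodic points\<close>

lemma funpow_fixpoint: "g x = x \<Longrightarrow> (g ^^ n) x = x"
  by (induction n) auto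

lemma funpow_mult_Suc: "(g ^^ (m * Suc k)) x = (g ^^ (m * k)) ((g ^^ m) x)"
  by (simp add: funpow_add add.commute[of m])

lemma periodic_funpow_mult: "(g ^^ n) x = x \<Longrightarrow> (g ^^ (n * j)) x = x"
  by (simp add: funpow_mult[symmetric] funpow_fixpoint)

text \<open>The iterate of order \<open>n * i\<close> factors through the \<open>i\<close>-th one
  and fixes both points, so the \<open>i\<close>-th iterate cannot identify them.\<close>

lemma periodic_funpow_inj:
  assumes "n > 0" "(g ^^ n) p = p" "(g ^^ n) q = q" "(g ^^ i) p = (g ^^ i) q"
  shows "p = q"
proof -
  have "n * i = (n - 1) * i + i"
    using assms(1) by (cases n) auto
  then have *: "(g ^^ (n * i)) x = (g ^^ ((n - 1) * i)) ((g ^^ i) x)" for x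
    by (simp add: funpow_add)
  show ?thesis
    using *[of p] *[of q] periodic_funpow_mult[OF assms(2), of i]
      periodic_funpow_mult[OF assms(3), of i] assms(4) by simp
qed

section \<open>Fixed points and periodic points of a transitive interval map\<close>

locale interval_map =
  fixes I :: "real set" and f :: "real \<Rightarrow> real"
  assumes nondeg: "nondeg_interval I"
    and cont: "continuous_on I f"
    and self: "f ` I \<subseteq> I"
begin

lemma ivl_I: "is_interval I"
  using nondeg unfolding nondeg_interval_def by blast

lemma closed_segment_in: "x \<in> I \<Longrightarrow> y \<in> I \<Longrightarrow> {x..y} \<subseteq> I"
  using ivl_I by (meson atLeastAtMost_iff mem_is_interval_1_I subsetI)

lemma f_in: "x \<in> I \<Longrightarrow> f x \<in> I"
  using self by blast

lemma funpow_in: "x \<in> I \<Longrightarrow> (f ^^ n) x \<in> I"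
  by (induction n) (use self in auto)

lemma funpow_image_in: "A \<subseteq> I \<Longrightarrow> (f ^^ n) ` A \<subseteq> I"
  using funpow_in by blast

lemma continuous_on_funpow: "continuous_on I (f ^^ n)"
proof (induction n)
  case 0
  show ?case by (simp add: continuous_on_id id_def)
next
  case (Suc n)
  have "continuous_on ((f ^^ n) ` I) f"
    using cont continuous_on_subset funpow_image_in by blast
  then show ?case
    using continuous_on_compose[OF Suc] by simp
qed

lemma is_interval_funpow_image: "is_interval J \<Longrightarrow> J \<subseteq> I \<Longrightarrow> is_interval ((f ^^ n) ` J)"
  by (meson connected_continuous_image continuous_on_funpow continuous_on_subset is_interval_connected_1)

text \<open>Intermediate value theorem for \<open>f^n - id\<close>. The order of \<open>x\<close>
  and \<open>y\<close> is left open, because callers know only in which direction each point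
  moves.\<close>

lemma fixed_point_between:
  assumes "x \<in> I" "y \<in> I" "(f ^^ n) x \<le> x" "y \<le> (f ^^ n) y"
  obtains z where "(f ^^ n) z = z" "min x y \<le> z" "z \<le> max x y" "z \<in> I"
proof -
  let ?h = "\<lambda>t. (f ^^ n) t - t"
  have "continuous_on I ?h"
    by (intro continuous_intros continuous_on_funpow)
  moreover have sub: "{min x y..max x y} \<subseteq> I"
    using assms(1,2) closed_segment_in by (metis max_def min_def)
  ultimately have "connected (?h ` {min x y..max x y})"
    by (meson connected_Icc connected_continuous_image continuous_on_subset)
  moreover have "?h x \<in> ?h ` {min x y..max x y}" "?h y \<in> ?h ` {min x y..max x y}"
    by auto
  ultimately have "0 \<in> ?h ` {min x y..max x y}"
    by (rule connectedD_interval) (use assms(3,4) in auto)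
  then show ?thesis
    using that sub by auto
qed

text \<open>Without periodic points each \<open>f^n - id\<close> has one sign on the whole interval.
  A return time that moves a point down passes this to all its multiples, and likewise for up.
  Transitivity provides a return of each kind, and the product of the two times would have both
  signs.\<close>

lemma periodic_point_in_interval:
  assumes tr: "transitive_on I f" and ab: "a < b" "{a<..<b} \<subseteq> I"
  obtains p n where "p \<in> {a<..<b}" "n > 0" "(f ^^ n) p = p"
proof (rule ccontr)
  assume no: "\<not> thesis"
  have noper: "(f ^^ n) x \<noteq> x" if "n > 0" "x \<in> {a<..<b}" for n x
    using no \<open>\<And>n p. p \<in> {a<..<b} \<Longrightarrow> 0 < n \<Longrightarrow> (f ^^ n) p = p \<Longrightarrow> thesis\<close> that by blast
  have same: "((f ^^ n) x < x) = ((f ^^ n) y < y)"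
    if n: "n > 0" and xy: "x \<in> {a<..<b}" "y \<in> {a<..<b}" for n x y
  proof (rule ccontr)
    assume ne: "((f ^^ n) x < x) \<noteq> ((f ^^ n) y < y)"
    have I: "x \<in> I" "y \<in> I" using xy ab by auto
    have "\<exists>z. (f ^^ n) z = z \<and> min x y \<le> z \<and> z \<le> max x y"
    proof (cases "(f ^^ n) x < x")
      case True
      then show ?thesis
        using fixed_point_between[of x y n] I ne by (metis less_eq_real_def not_le)
    next
      case False
      then show ?thesis
        using fixed_point_between[of y x n] I ne
        by (metis less_eq_real_def not_le min.commute max.commute)
    qed
    then obtain z where "(f ^^ n) z = z" "min x y \<le> z" "z \<le> max x y" by blast
    moreover have "z \<in> {a<..<b}"
      using calculation xy by (auto simp: min_def max_def split: if_splits)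
    ultimately show False
      using noper[OF n] by blast
  qed
  \<comment> \<open>The point reached after \<open>m * k\<close> steps may lie outside the interval.
    Only \<open>f^m x\<close> must lie inside, so that the sign of \<open>f^(m * k) - id\<close>
    carries over from \<open>x\<close> to it.\<close>
  have down: "(f ^^ (m * k)) x < x"
    if m: "m > 0" and x: "x \<in> {a<..<b}" "(f ^^ m) x \<in> {a<..<b}" "(f ^^ m) x < x" and "k > 0" for m x k
    using \<open>k > 0\<close>
  proof (induction k rule: nat_induct_non_zero)
    case 1
    then show ?case using x by simp
  next
    case (Suc k)
    have "(f ^^ (m * k)) x < x" "m * k > 0"
      using Suc m by auto
    then have "(f ^^ (m * k)) ((f ^^ m) x) < (f ^^ m) x"
      using same x by blast
    then show ?case
      using x(3) unfolding funpow_mult_Suc by linarith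
  qed
  have up: "(f ^^ (m * k)) x > x"
    if m: "m > 0" and x: "x \<in> {a<..<b}" "(f ^^ m) x \<in> {a<..<b}" "(f ^^ m) x > x" and "k > 0" for m x k
    using \<open>k > 0\<close>
  proof (induction k rule: nat_induct_non_zero)
    case 1
    then show ?case using x by simp
  next
    case (Suc k)
    have "\<not> (f ^^ (m * k)) x < x" "m * k > 0"
      using Suc m by auto
    then have "(f ^^ (m * k)) ((f ^^ m) x) > (f ^^ m) x"
      using same noper x by (metis linorder_neqE)
    then show ?case
      using x(3) unfolding funpow_mult_Suc by linarith
  qed
  \<comment> \<open>A passage from the left half to the right half is an upward return, the reverse
    passage a downward one.\<close>
  define c where "c = (a + b) / 2"
  have c: "a < c" "c < b"
    using ab by (auto simp: c_def)
  obtain k x where k: "k > 0" "x \<in> {a<..<c}" "(f ^^ k) x \<in> {c<..<b}"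
    using transitive_on_intervalE[OF tr, of a c c b] c ab by (auto simp: subset_iff)
  obtain l y where l: "l > 0" "y \<in> {c<..<b}" "(f ^^ l) y \<in> {a<..<c}"
    using transitive_on_intervalE[OF tr, of c b a c] c ab by (auto simp: subset_iff)
  have "(f ^^ (k * l)) x > x"
    using up[of k x l] k l c by auto
  moreover have "(f ^^ (l * k)) y < y"
    using down[of l y k] k l c by auto
  ultimately show False
    using same[of "k * l" x y] k l c by (auto simp: mult.commute)
qed


lemma openin_I_preimage: "open T \<Longrightarrow> openin (top_of_set I) (I \<inter> f -` T)"
  using cont continuous_openin_preimage_gen by blast

lemma openin_meets_interior:
  assumes "openin (top_of_set I) U" "U \<noteq> {}"
  obtains x where "x \<in> U" "x \<in> interior I"
proof -
  obtain a b where "a < b" "{a..b} \<subseteq> U" "{a..b} \<subseteq> interior I"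
    using openin_interval_contains_interval[OF nondeg assms] by metis
  moreover from this have "a \<in> {a..b}" by simp
  ultimately show ?thesis
    using that[of a] by blast
qed

lemma interior_interval: "x \<in> interior I \<Longrightarrow> y \<in> interior I \<Longrightarrow> {x..y} \<subseteq> interior I"
  using mem_is_interval_1_I[of "interior I" x y] ivl_I
  by (auto simp: is_interval_convex_1 convex_interior)

lemma interior_I_interval:
  obtains a b where "a < b" "{a..b} \<subseteq> interior I"
proof -
  have "I \<noteq> {}" using nondeg unfolding nondeg_interval_def by blast
  then show ?thesis
    using openin_interval_contains_interval[OF nondeg, of I] that by (metis openin_subtopology_self)
qed

lemma interiorE:
  assumes "x \<in> interior I"
  obtains a b where "a < x" "x < b" "{a..b} \<subseteq> I"
  using open_real_contains_interval[OF open_interior assms] interior_subset by (metis subset_trans)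

text \<open>If \<open>f\<close> never moved a point down, orbits would be nondecreasing and could
  not pass from right to left; the same holds with directions reversed. Both strict inequalities are
  open conditions, so their witnesses can be moved into the interior, and a fixed point between them
  stays there.\<close>

lemma transitive_interior_fixed_point:
  assumes tr: "transitive_on I f"
  obtains z where "z \<in> interior I" "f z = z"
proof -
  obtain a b where ab: "a < b" "{a..b} \<subseteq> interior I"
    using interior_I_interval .
  define c where "c = (a + b) / 2"
  have c: "a < c" "c < b"
    using ab by (auto simp: c_def)
  have sub: "{a<..<c} \<subseteq> I" "{c<..<b} \<subseteq> I"
    using ab c interior_subset by fastforce+
  have "\<exists>x\<in>I. f x < x"
  proof (rule ccontr)
    assume no: "\<not> (\<exists>x\<in>I. f x < x)"
    obtain k x where kx: "k > 0" "x \<in> {c<..<b}" "(f ^^ k) x \<in> {a<..<c}"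
      using transitive_on_intervalE[OF tr c(2) sub(2) c(1) sub(1)] .
    have "x \<in> I" using kx sub by blast
    then have "(f ^^ j) x \<ge> x" for j
    proof (induction j)
      case (Suc j)
      then show ?case
        using no funpow_in[of x j] by (simp add: not_less) (meson order_trans)
    qed simp
    then show False using kx by (meson greaterThanLessThan_iff less_asym less_le_trans not_le)
  qed
  moreover have cont': "continuous_on I (\<lambda>x. f x - x)"
    by (intro continuous_intros cont)
  moreover have "I \<inter> (\<lambda>x. f x - x) -` {..<0} = {x \<in> I. f x < x}"
    by auto
  ultimately have "openin (top_of_set I) {x \<in> I. f x < x}" "{x \<in> I. f x < x} \<noteq> {}"
    using continuous_openin_preimage_gen[OF cont' open_lessThan, of 0] by auto
  then obtain x where x: "x \<in> interior I" "f x < x"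
    using openin_meets_interior by (metis (no_types, lifting) mem_Collect_eq)
  have "\<exists>x\<in>I. x < f x"
  proof (rule ccontr)
    assume no: "\<not> (\<exists>x\<in>I. x < f x)"
    obtain k x where kx: "k > 0" "x \<in> {a<..<c}" "(f ^^ k) x \<in> {c<..<b}"
      using transitive_on_intervalE[OF tr c(1) sub(1) c(2) sub(2)] .
    have "x \<in> I" using kx sub by blast
    then have "(f ^^ j) x \<le> x" for j
    proof (induction j)
      case (Suc j)
      then show ?case
        using no funpow_in[of x j] by (simp add: not_less) (meson order_trans)
    qed simp
    then show False using kx by (meson greaterThanLessThan_iff less_asym less_le_trans not_le)
  qed
  moreover have "I \<inter> (\<lambda>x. f x - x) -` {0<..} = {x \<in> I. x < f x}"
    by auto
  ultimately have "openin (top_of_set I) {x \<in> I. x < f x}" "{x \<in> I. x < f x} \<noteq> {}"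
    using continuous_openin_preimage_gen[OF cont' open_greaterThan, of 0] by auto
  then obtain y where y: "y \<in> interior I" "y < f y"
    using openin_meets_interior by (metis (no_types, lifting) mem_Collect_eq)
  have "x \<in> I" "y \<in> I"
    using x y interior_subset by blast+
  then obtain z where z: "f z = z" "min x y \<le> z" "z \<le> max x y"
    using fixed_point_between[of x y 1] x y by auto
  have "z \<in> interior I"
    using z(2,3) interior_interval[OF x(1) y(1)] interior_interval[OF y(1) x(1)]
    by (cases "x \<le> y") (auto simp: subset_iff)
  then show ?thesis
    using that z(1) by blast
qed

text \<open>The form in which every converse direction uses the failure of the same-side condition,
  applied at an interior fixed point supplied by transitivity.\<close>

lemma not_same_side_swap:
  assumes tr: "transitive_on I f" and no: "\<not> transitive_with_same_side_point I f"
  obtains z where "z \<in> interior I" "f z = z"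
    "\<forall>x\<in>I. (x \<le> z \<longrightarrow> z \<le> f x) \<and> (z \<le> x \<longrightarrow> f x \<le> z)"
proof -
  obtain z where z: "z \<in> interior I" "f z = z"
    using transitive_interior_fixed_point[OF tr] .
  then have "z \<in> I" using interior_subset by blast
  then have *: "\<not> (z < min c (f c) \<or> max c (f c) < z)" if "c \<in> I" "c \<noteq> z" for c
    using no tr z that unfolding transitive_with_same_side_point_def by blast
  show ?thesis
  proof (rule that[OF z], intro ballI conjI impI)
    fix x assume x: "x \<in> I"
    show "z \<le> f x" if "x \<le> z"
      using *[OF x] that z by (cases "x = z") (auto simp: not_less)
    show "f x \<le> z" if "z \<le> x"
      using *[OF x] that z by (cases "x = z") (auto simp: not_less)
  qed
qed

text \<open>The given fixed point may be an endpoint of \<open>I\<close>. If it differs from an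
  interior fixed point \<open>z\<close>, it can itself play the role of \<open>c\<close>, as it lies
  on the same side of \<open>z\<close> as its own image.\<close>

lemma same_side_interior:
  assumes "transitive_with_same_side_point I f"
  obtains z c where "z \<in> interior I" "f z = z" "c \<in> I"
    "z < c \<and> z < f c \<or> c < z \<and> f c < z"
proof -
  obtain z0 c0 where 0: "z0 \<in> I" "f z0 = z0" "c0 \<in> I" "c0 \<noteq> z0"
      "z0 < min c0 (f c0) \<or> max c0 (f c0) < z0"
    and tr: "transitive_on I f"
    using assms unfolding transitive_with_same_side_point_def by blast
  obtain z where z: "z \<in> interior I" "f z = z"
    using transitive_interior_fixed_point[OF tr] .
  show ?thesis
  proof (cases "z0 = z")
    case True
    then show ?thesis using that[OF z 0(3)] 0 by auto
  next
    case False
    then have "z < z0 \<and> z < f z0 \<or> z0 < z \<and> f z0 < z"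
      using 0(2) by auto
    then show ?thesis using that[OF z 0(1)] by blast
  qed
qed

text \<open>Role of \<open>u\<close> and \<open>v\<close>: an interval that accumulates at \<open>z\<close> and reaches past \<open>u\<close> and \<open>v\<close> is mapped across \<open>z\<close>.\<close>
lemma same_side_crossing:
  assumes "transitive_with_same_side_point I f"
  obtains z u v where "z \<in> interior I" "f z = z" "u \<in> interior I" "v \<in> interior I"
    "z < u \<and> z < v \<or> u < z \<and> v < z" "f u < z" "z < f v"
proof -
  have tr: "transitive_on I f"
    using assms unfolding transitive_with_same_side_point_def by blast
  obtain z c where z: "z \<in> interior I" "f z = z" and c: "c \<in> I"
    "z < c \<and> z < f c \<or> c < z \<and> f c < z"
    using same_side_interior[OF assms] .
  obtain a b where ab: "a < z" "z < b" "{a..b} \<subseteq> I"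
    using interiorE[OF z(1)] .
  have sub: "{a<..<z} \<subseteq> I" "{z<..<b} \<subseteq> I"
    using ab by (auto simp: subset_iff)
  have op: "openin (top_of_set I) {x \<in> I. x \<in> T \<and> f x \<in> T'}" if "open T" "open T'" for T T'
  proof -
    have "{x \<in> I. x \<in> T \<and> f x \<in> T'} = (I \<inter> T) \<inter> (I \<inter> f -` T')" by auto
    then show ?thesis
      using openin_I_preimage[OF that(2)] that(1) by (metis openin_Int openin_open_Int)
  qed
  show ?thesis
    using c(2)
  proof
    assume c': "z < c \<and> z < f c"
    \<comment> \<open>Otherwise no orbit could leave the closed right side of \<open>z\<close>,
      against transitivity. The other crossing point \<open>v\<close> is an interior substitute for
      \<open>c\<close>.\<close>
    have "\<exists>x\<in>I. z < x \<and> f x < z"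
    proof (rule ccontr)
      assume no: "\<not> (\<exists>x\<in>I. z < x \<and> f x < z)"
      obtain k x where kx: "k > 0" "x \<in> {z<..<b}" "(f ^^ k) x \<in> {a<..<z}"
        using transitive_on_intervalE[OF tr ab(2) sub(2) ab(1) sub(1)] .
      have "x \<in> I" using kx sub by blast
      then have "(f ^^ j) x \<ge> z" for j
      proof (induction j)
        case (Suc j)
        then show ?case
          using no z(2) funpow_in[of x j] by (cases "(f ^^ j) x = z") (auto simp: not_less)
      qed (use kx in auto)
      then show False using kx by (meson greaterThanLessThan_iff not_le)
    qed
    then obtain u where u: "u \<in> interior I" "z < u" "f u < z"
      using openin_meets_interior[OF op[of "{z<..}" "{..<z}"]] by auto
    obtain v where v: "v \<in> interior I" "z < v" "z < f v"
      using openin_meets_interior[OF op[of "{z<..}" "{z<..}"]] c' c(1) by auto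
    show ?thesis using that[OF z u(1) v(1)] u v by blast
  next
    assume c': "c < z \<and> f c < z"
    have "\<exists>x\<in>I. x < z \<and> z < f x"
    proof (rule ccontr)
      assume no: "\<not> (\<exists>x\<in>I. x < z \<and> z < f x)"
      obtain k x where kx: "k > 0" "x \<in> {a<..<z}" "(f ^^ k) x \<in> {z<..<b}"
        using transitive_on_intervalE[OF tr ab(1) sub(1) ab(2) sub(2)] .
      have "x \<in> I" using kx sub by blast
      then have "(f ^^ j) x \<le> z" for j
      proof (induction j)
        case (Suc j)
        then show ?case
          using no z(2) funpow_in[of x j] by (cases "(f ^^ j) x = z") (auto simp: not_less)
      qed (use kx in auto)
      then show False using kx by (meson greaterThanLessThan_iff not_le)
    qed
    then obtain v where v: "v \<in> interior I" "v < z" "z < f v"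
      using openin_meets_interior[OF op[of "{..<z}" "{z<..}"]] by auto
    obtain u where u: "u \<in> interior I" "u < z" "f u < z"
      using openin_meets_interior[OF op[of "{..<z}" "{..<z}"]] c' c(1) by auto
    show ?thesis using that[OF z u(1) v(1)] u v by blast
  qed
qed

end

section \<open>The cyclic family of growing interval images\<close>

locale periodic_interval = interval_map +
  fixes p q :: real and n :: nat
  assumes tr: "transitive_on I f"
    and pq: "p < q" "{p..q} \<subseteq> I"
    and n: "n > 0" and per: "(f ^^ n) p = p" "(f ^^ n) q = q"
begin

definition F :: "nat \<Rightarrow> real set" where "F i = (f ^^ i) ` {p..q}"

text \<open>The index runs over all naturals instead of the residues modulo \<open>n\<close>, so
  that \<open>f\<close> simply raises it by one.\<close>

definition J :: "nat \<Rightarrow> real set" where "J i = (\<Union>j. F (i + n * j))"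

lemma F_interval: "is_interval (F i)"
  unfolding F_def using is_interval_funpow_image pq(2) is_interval_cc by blast

lemma F_subset: "F i \<subseteq> I"
  unfolding F_def using funpow_image_in pq(2) by blast

lemma F_Suc: "F (Suc i) = f ` F i"
  unfolding F_def by (simp add: image_comp)

lemma F_add: "F (i + k) = (f ^^ i) ` F k"
  unfolding F_def by (simp add: image_comp funpow_add)

text \<open>\<open>f^n\<close> fixes both endpoints, so the interval \<open>F n\<close> contains
  everything between them; applying \<open>f^i\<close> gives the general case.\<close>

lemma F_step: "F i \<subseteq> F (i + n)"
proof -
  have "p \<in> F n" "q \<in> F n"
    unfolding F_def using per pq(1) by (metis atLeastAtMost_iff image_eqI less_imp_le order_refl)+
  then have "F 0 \<subseteq> F n"
    using mem_is_interval_1_I[OF F_interval[of n], of p q] by (auto simp: F_def[of 0])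
  then show ?thesis
    unfolding F_add[of i n] using F_add[of i 0] by (simp add: image_mono)
qed

lemma F_mono: "j \<le> k \<Longrightarrow> F (i + n * j) \<subseteq> F (i + n * k)"
proof (induction k rule: dec_induct)
  case (step k)
  then show ?case
    using F_step[of "i + n * k"] by (simp add: algebra_simps)
qed simp

lemma J_interval: "is_interval (J i)"
proof -
  have "y \<in> J i" if xz: "x \<in> J i" "z \<in> J i" and y: "x \<le> y" "y \<le> z" for x y z
  proof -
    obtain j k where "x \<in> F (i + n * j)" "z \<in> F (i + n * k)"
      using xz unfolding J_def by blast
    then have "x \<in> F (i + n * max j k)" "z \<in> F (i + n * max j k)"
      using F_mono[of j "max j k" i] F_mono[of k "max j k" i] by auto
    then have "y \<in> F (i + n * max j k)"
      using mem_is_interval_1_I[OF F_interval] y by blast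
    then show ?thesis unfolding J_def by blast
  qed
  then show ?thesis
    unfolding is_interval_1 by blast
qed

lemma J_between: "x \<in> J i \<Longrightarrow> z \<in> J i \<Longrightarrow> x \<le> y \<Longrightarrow> y \<le> z \<Longrightarrow> y \<in> J i"
  using mem_is_interval_1_I[OF J_interval] by blast

lemma J_subset: "J i \<subseteq> I"
  unfolding J_def using F_subset by blast

lemma J_Suc: "J (Suc i) = f ` J i"
  unfolding J_def image_UN by (simp flip: F_Suc)

lemma J_image: "x \<in> J i \<Longrightarrow> f x \<in> J (Suc i)"
  by (simp add: J_Suc)

lemma J_funpow_image: "x \<in> J i \<Longrightarrow> (f ^^ m) x \<in> J (i + m)"
  by (induction m) (use J_image in auto)

text \<open>Raising the index by \<open>n\<close> drops the first member of the union, which is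
  harmless because the members increase.\<close>

lemma J_periodic: "J (i + n * m) = J i"
proof -
  have step: "J (i + n) = J i" for i
  proof
    have "F (i + n + n * j) = F (i + n * Suc j)" for j
      by (simp add: algebra_simps)
    then show "J (i + n) \<subseteq> J i"
      unfolding J_def by blast
    have "F (i + n * j) \<subseteq> F (i + n + n * j)" for j
      using F_step[of "i + n * j"] by (simp add: algebra_simps)
    then show "J i \<subseteq> J (i + n)"
      unfolding J_def by blast
  qed
  show ?thesis
  proof (induction m)
    case (Suc m)
    then show ?case using step[of "i + n * m"] by (simp add: algebra_simps)
  qed simp
qed

text \<open>The \<open>J i\<close> together contain all forward images of \<open>{p..q}\<close>, and
  reducing the time modulo \<open>n\<close> leaves finitely many of them. Density of each single
  \<open>J i\<close> needs a common interval and comes later.\<close>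

lemma J_dense_family:
  assumes "c < d" "{c<..<d} \<subseteq> I"
  obtains i x where "i < n" "x \<in> J i" "c < x" "x < d"
proof -
  have "{p<..<q} \<subseteq> I" using pq by (auto simp: subset_iff)
  then obtain k x where kx: "x \<in> {p<..<q}" "(f ^^ k) x \<in> {c<..<d}"
    using transitive_on_intervalE[OF tr pq(1) _ assms] by metis
  have "(f ^^ k) x \<in> F (k mod n + n * (k div n))"
    using kx(1) unfolding F_def by auto
  then have "(f ^^ k) x \<in> J (k mod n)"
    unfolding J_def by blast
  then show ?thesis
    using that[of "k mod n" "(f ^^ k) x"] n kx(2) by auto
qed

text \<open>The union of finitely many \<open>J i\<close> is dense near \<open>z\<close>, so one
  closure contains \<open>z\<close>; continuity at the fixed point carries this along the whole
  cycle.\<close>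

lemma fixed_point_in_closure_J:
  assumes z: "z \<in> interior I" "f z = z"
  shows "z \<in> closure (J k)"
proof -
  have zI: "z \<in> I" using z interior_subset by blast
  have "\<exists>i<n. z \<in> closure (J i)"
  proof (rule ccontr)
    assume no: "\<not> (\<exists>i<n. z \<in> closure (J i))"
    let ?T = "interior I \<inter> (\<Inter>i\<in>{..<n}. - closure (J i))"
    have "open ?T" by (intro open_Int open_INT ballI) auto
    moreover have "z \<in> ?T" using z no by auto
    ultimately obtain a b where ab: "a < z" "z < b" "{a..b} \<subseteq> ?T"
      using open_real_contains_interval by blast
    have "a < b" "{a<..<b} \<subseteq> I"
      using ab interior_subset by fastforce+
    then obtain i x where x: "i < n" "x \<in> J i" "a < x" "x < b"
      using J_dense_family by metis
    have "x \<in> {a..b}"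
      using x by simp
    then have "x \<in> ?T"
      by (rule subsetD[OF ab(3)])
    then have "x \<in> - closure (J i)"
      using x(1) by simp
    then show False using x(2) closure_subset by blast
  qed
  then obtain i where i: "z \<in> closure (J i)" by blast
  have "z \<in> closure (J (i + m))" for m
  proof (induction m)
    case (Suc m)
    show ?case
    proof (rule ccontr)
      assume no: "z \<notin> closure (J (i + Suc m))"
      have "openin (top_of_set I) (I \<inter> f -` (- closure (J (i + Suc m))))"
        by (rule openin_I_preimage) auto
      then obtain T where T: "open T" "I \<inter> f -` (- closure (J (i + Suc m))) = I \<inter> T"
        using openin_open by metis
      have "z \<in> T" using T(2) no z(2) zI by auto
      then have "T \<inter> J (i + m) \<noteq> {}"
        using Suc T(1) by (metis IntI empty_iff open_Int_closure_eq_empty)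
      then obtain y where y: "y \<in> T" "y \<in> J (i + m)" by blast
      then have "f y \<notin> closure (J (i + Suc m))"
        using T(2) J_subset by blast
      moreover have "f y \<in> J (i + Suc m)"
        using J_image[OF y(2)] by simp
      ultimately show False using closure_subset by blast
    qed
  qed (use i in simp)
  \<comment> \<open>The induction moves only forward, so the target \<open>k\<close> is first raised
    by a multiple of \<open>n\<close> beyond \<open>i\<close>.\<close>
  moreover have "i \<le> k + n * i" using n by (cases n) auto
  ultimately have "z \<in> closure (J (k + n * i))"
    by (metis le_add_diff_inverse)
  then show ?thesis by (simp add: J_periodic)
qed

text \<open>\<open>z\<close> itself need not belong to \<open>J k\<close>; an interval that
  accumulates at \<open>z\<close> still contains everything strictly between \<open>z\<close> and
  any of its points.\<close>

lemma J_from_closure: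
  assumes "z \<in> closure (J k)" "x \<in> J k" "z < y \<and> y \<le> x \<or> x \<le> y \<and> y < z"
  shows "y \<in> J k"
  using assms(3)
proof
  assume y: "z < y \<and> y \<le> x"
  then have "{..<y} \<inter> J k \<noteq> {}"
    using assms(1) open_Int_closure_eq_empty[of "{..<y}" "J k"] by auto
  then obtain t where "t < y" "t \<in> J k" by blast
  then show ?thesis using J_between[of t k x y] assms(2) y by simp
next
  assume y: "x \<le> y \<and> y < z"
  then have "{y<..} \<inter> J k \<noteq> {}"
    using assms(1) open_Int_closure_eq_empty[of "{y<..}" "J k"] by auto
  then obtain t where "y < t" "t \<in> J k" by blast
  then show ?thesis using J_between[of x k t y] assms(2) y by simp
qed

text \<open>Since \<open>u\<close> and \<open>v\<close> are interior, some \<open>J i\<close> has a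
  point beyond both of them, and it fills the gap back towards \<open>z\<close>.\<close>

lemma J_contains_side_points:
  assumes z: "z \<in> interior I" "f z = z" and uv: "u \<in> interior I" "v \<in> interior I"
    "z < u \<and> z < v \<or> u < z \<and> v < z"
  obtains k where "u \<in> J k" "v \<in> J k"
  using uv(3)
proof
  assume *: "z < u \<and> z < v"
  have "max u v \<in> interior I" using uv by (simp add: max_def)
  then obtain a b where ab: "a < max u v" "max u v < b" "{a..b} \<subseteq> I"
    using interiorE by blast
  then have "{max u v<..<b} \<subseteq> I" by (auto simp: subset_iff)
  then obtain i x where x: "x \<in> J i" "max u v < x"
    using J_dense_family[OF ab(2)] by metis
  then have "u \<in> J i" "v \<in> J i"
    using J_from_closure[OF fixed_point_in_closure_J[OF z] x(1)] * by auto
  then show ?thesis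
    using that by blast
next
  assume *: "u < z \<and> v < z"
  have "min u v \<in> interior I" using uv by (simp add: min_def)
  then obtain a b where ab: "a < min u v" "min u v < b" "{a..b} \<subseteq> I"
    using interiorE by blast
  then have "{a<..<min u v} \<subseteq> I" by (auto simp: subset_iff)
  then obtain i x where x: "x \<in> J i" "x < min u v"
    using J_dense_family[OF ab(1)] by metis
  then have "u \<in> J i" "v \<in> J i"
    using J_from_closure[OF fixed_point_in_closure_J[OF z] x(1)] * by auto
  then show ?thesis
    using that by blast
qed


text \<open>The points \<open>u\<close> and \<open>v\<close> put both sides of \<open>z\<close> into one \<open>J k\<close>; at least one side then persists
  under \<open>f\<close>, either because \<open>f\<close> maps it over itself near \<open>z\<close> or because \<open>f\<close> exchanges both sides.\<close>
lemma J_common_interval: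
  assumes z: "z \<in> interior I" "f z = z" and uv: "u \<in> interior I" "v \<in> interior I"
    "z < u \<and> z < v \<or> u < z \<and> v < z" and fuv: "f u < z" "z < f v"
  obtains a b where "a < b" "\<And>i. {a<..<b} \<subseteq> J i"
proof -
  note result = that
  obtain k where k: "u \<in> J k" "v \<in> J k"
    using J_contains_side_points[OF z uv] .
  \<comment> \<open>One step after \<open>k\<close> the set contains \<open>f u\<close> and
    \<open>f v\<close>, which lie on opposite sides of \<open>z\<close>. By periodicity this tail of
    the family still runs through every \<open>J i\<close>.\<close>
  define A where "A m = J (Suc k + m)" for m
  have A_image: "f x \<in> A (Suc m)" if "x \<in> A m" for x m
    using J_image that unfolding A_def by simp
  have A_ivl: "y \<in> A m" if "x \<in> A m" "w \<in> A m" "x \<le> y" "y \<le> w" for x y w m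
    using J_between that unfolding A_def by blast
  have A_sub: "A m \<subseteq> I" for m
    unfolding A_def by (rule J_subset)
  have A0: "f u \<in> A 0" "f v \<in> A 0"
    using J_image k unfolding A_def by auto
  have zA: "z \<in> A m" for m
  proof (induction m)
    case 0
    show ?case using A_ivl[OF A0] fuv by simp
  next
    case (Suc m)
    then show ?case using A_image z(2) by metis
  qed
  have all_J: "\<exists>m. J i = A m" for i
  proof -
    have "Suc k \<le> n * Suc k"
      using n by (cases n) auto
    then have "Suc k + (i + n * Suc k - Suc k) = i + n * Suc k"
      by simp
    then show ?thesis
      using J_periodic[of i "Suc k"] unfolding A_def by metis
  qed
  \<comment> \<open>Each set reaches some distance to the right of \<open>z\<close>; only
    \<open>n\<close> of them are distinct, so the minimum of these distances serves all.\<close>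
  have right: thesis if "\<And>m. \<exists>x\<in>A m. z < x"
  proof -
    have "\<forall>i. \<exists>x\<in>J i. z < x"
      using that all_J by metis
    then obtain x where x: "\<And>i. x i \<in> J i" "\<And>i. z < x i" by metis
    define b where "b = Min (x ` {..<n})"
    have b: "z < b" "\<And>i. i < n \<Longrightarrow> b \<le> x i"
      unfolding b_def using Min_gr_iff[of "x ` {..<n}" z] n x(2) by (auto simp: lessThan_empty_iff)
    have "{z<..<b} \<subseteq> J i" for i
    proof
      fix y assume y: "y \<in> {z<..<b}"
      have "z \<in> J i" using zA all_J by metis
      moreover have "J i = J (i mod n)"
        using J_periodic[of "i mod n" "i div n"] by simp
      moreover have "y \<le> x (i mod n)"
        using b(2)[of "i mod n"] n y by simp
      ultimately show "y \<in> J i"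
        using J_between[of z "i mod n" "x (i mod n)" y] x(1)[of "i mod n"] y by simp
    qed
    then show thesis using result b(1) by blast
  qed
  have left: thesis if "\<And>m. \<exists>x\<in>A m. x < z"
  proof -
    have "\<forall>i. \<exists>x\<in>J i. x < z"
      using that all_J by metis
    then obtain x where x: "\<And>i. x i \<in> J i" "\<And>i. x i < z" by metis
    define b where "b = Max (x ` {..<n})"
    have b: "b < z" "\<And>i. i < n \<Longrightarrow> x i \<le> b"
      unfolding b_def using Max_less_iff[of "x ` {..<n}" z] n x(2) by (auto simp: lessThan_empty_iff)
    have "{b<..<z} \<subseteq> J i" for i
    proof
      fix y assume y: "y \<in> {b<..<z}"
      have "z \<in> J i" using zA all_J by metis
      moreover have "J i = J (i mod n)"
        using J_periodic[of "i mod n" "i div n"] by simp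
      moreover have "x (i mod n) \<le> y"
        using b(2)[of "i mod n"] n y by simp
      ultimately show "y \<in> J i"
        using J_between[of "x (i mod n)" "i mod n" z y] x(1)[of "i mod n"] y by simp
    qed
    then show thesis using result b(1) by blast
  qed
  \<comment> \<open>If \<open>f\<close> sent the whole interval to \<open>z\<close>, its orbits
    would stay at \<open>z\<close> and never return to the interval.\<close>
  have not_const: "\<exists>x\<in>{a<..<b}. f x \<noteq> z" if ab: "a < b" "{a<..<b} \<subseteq> I" "z \<notin> {a<..<b}" for a b
  proof (rule ccontr)
    assume no: "\<not> (\<exists>x\<in>{a<..<b}. f x \<noteq> z)"
    obtain k x where k: "k > 0" "x \<in> {a<..<b}" "(f ^^ k) x \<in> {a<..<b}"
      using transitive_on_intervalE[OF tr ab(1,2) ab(1,2)] .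
    obtain l where "k = Suc l" using k(1) by (cases k) auto
    then have "(f ^^ k) x = (f ^^ l) (f x)"
      by (simp add: funpow_swap1)
    then have "(f ^^ k) x = z"
      using no k(2) z(2) funpow_fixpoint[of f z l] by auto
    then show False using k(3) ab(3) by simp
  qed
  show thesis
  proof (cases "\<forall>e>z. \<exists>x\<in>I. z < x \<and> x < e \<and> z < f x")
    case True
    have "\<exists>x\<in>A m. z < x" for m
    proof (induction m)
      case 0
      then show ?case using A0(2) fuv(2) by blast
    next
      case (Suc m)
      then obtain w where w: "w \<in> A m" "z < w" by blast
      then obtain x where "z < x" "x < w" "z < f x" using True by blast
      then show ?case using A_image A_ivl[OF zA w(1), of x] by force
    qed
    then show ?thesis by (rule right)
  next
    case False
    then obtain e where e: "z < e" "\<And>x. x \<in> I \<Longrightarrow> z < x \<Longrightarrow> x < e \<Longrightarrow> f x \<le> z"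
      by force
    show ?thesis
    proof (cases "\<forall>e<z. \<exists>x\<in>I. x < z \<and> e < x \<and> f x < z")
      case True
      have "\<exists>x\<in>A m. x < z" for m
      proof (induction m)
        case 0
        then show ?case using A0(1) fuv(1) by blast
      next
        case (Suc m)
        then obtain w where w: "w \<in> A m" "w < z" by blast
        then obtain x where "x < z" "w < x" "f x < z" using True by blast
        then show ?case using A_image A_ivl[OF w(1) zA, of x] by force
      qed
      then show ?thesis by (rule left)
    next
      case False
      then obtain e' where e': "e' < z" "\<And>x. x \<in> I \<Longrightarrow> x < z \<Longrightarrow> e' < x \<Longrightarrow> z \<le> f x"
        by force
      \<comment> \<open>Here \<open>f\<close> weakly exchanges the two sides near \<open>z\<close>,
        so the right side of one set comes from the left side of its predecessor and the induction
        must carry both. Strictness comes from \<open>not_const\<close>.\<close>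
      have "(\<exists>x\<in>A m. x < z) \<and> (\<exists>x\<in>A m. z < x)" for m
      proof (induction m)
        case 0
        then show ?case using A0 fuv by blast
      next
        case (Suc m)
        then obtain w w' where w: "w \<in> A m" "w < z" and w': "w' \<in> A m" "z < w'" by blast
        have "{z<..<min w' e} \<subseteq> A m" "{max w e'<..<z} \<subseteq> A m"
          using A_ivl[OF zA w'(1)] A_ivl[OF w(1) zA] by auto
        moreover have "z < min w' e" "max w e' < z"
          using w w' e(1) e'(1) by auto
        ultimately obtain x y where x: "x \<in> {z<..<min w' e}" "x \<in> A m" "f x \<noteq> z"
          and y: "y \<in> {max w e'<..<z}" "y \<in> A m" "f y \<noteq> z"
          using not_const[of z "min w' e"] not_const[of "max w e'" z] A_sub[of m]
          by (meson greaterThanLessThan_iff less_irrefl order_trans subsetD)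
        have "f x < z" "z < f y"
          using e(2)[of x] e'(2)[of y] x y A_sub[of m] by force+
        then show ?case using A_image x(2) y(2) by blast
      qed
      then show ?thesis using right by blast
    qed
  qed
qed

lemma J_dense:
  assumes ab: "a < b" "\<And>i. {a<..<b} \<subseteq> J i" and cd: "c < d" "{c<..<d} \<subseteq> I"
  obtains x where "x \<in> J i" "c < x" "x < d"
proof -
  have "{a<..<b} \<subseteq> I" using ab(2) J_subset by blast
  then obtain m x where x: "x \<in> {a<..<b}" "(f ^^ m) x \<in> {c<..<d}"
    using transitive_on_intervalE[OF tr ab(1) _ cd] by metis
  \<comment> \<open>All members contain \<open>{a<..<b}\<close>, so the starting index is free and
    is chosen \<open>m\<close> steps before the desired one. The summand \<open>n * m\<close> keeps
    the natural subtraction from truncating.\<close>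
  have "x \<in> J (i + n * m - m)"
    using x(1) ab(2) by blast
  then have "(f ^^ m) x \<in> J (i + n * m - m + m)"
    by (rule J_funpow_image)
  also have "i + n * m - m + m = i + n * m"
    using n by (cases n) auto
  finally show ?thesis
    using that x(2) J_periodic by auto
qed

text \<open>Interior endpoints leave room in \<open>I\<close> on both sides of
  \<open>{l1..l2}\<close>. Each dense \<open>J i\<close> has points there, the growing intervals
  \<open>F (i + n * j)\<close> capture both from some \<open>j\<close> on, and a maximum combines
  the \<open>n\<close> residues.\<close>

lemma F_eventually_covers:
  assumes ab: "a < b" "\<And>i. {a<..<b} \<subseteq> J i" and l: "l1 \<in> interior I" "l2 \<in> interior I"
  shows "\<exists>M. \<forall>m\<ge>M. {l1..l2} \<subseteq> F m"
proof -
  obtain c1 d1 where 1: "c1 < l1" "l1 < d1" "{c1..d1} \<subseteq> I" using interiorE[OF l(1)] .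
  obtain c2 d2 where 2: "c2 < l2" "l2 < d2" "{c2..d2} \<subseteq> I" using interiorE[OF l(2)] .
  have sub: "{c1<..<l1} \<subseteq> I" "{l2<..<d2} \<subseteq> I"
    using 1 2 by (auto simp: subset_iff)
  have "\<exists>j0. \<forall>j\<ge>j0. {l1..l2} \<subseteq> F (i + n * j)" for i
  proof -
    obtain x where x: "x \<in> J i" "x < l1" using J_dense[OF ab 1(1) sub(1)] .
    obtain y where y: "y \<in> J i" "l2 < y" using J_dense[OF ab 2(2) sub(2)] .
    obtain j1 j2 where j: "x \<in> F (i + n * j1)" "y \<in> F (i + n * j2)"
      using x(1) y(1) unfolding J_def by blast
    have "{l1..l2} \<subseteq> F (i + n * j)" if "j \<ge> max j1 j2" for j
    proof -
      have "x \<in> F (i + n * j)" "y \<in> F (i + n * j)"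
        using j F_mono[of j1 j i] F_mono[of j2 j i] that by auto
      then show ?thesis
        using mem_is_interval_1_I[OF F_interval, of x _ y] x(2) y(2) by auto
    qed
    then show ?thesis by blast
  qed
  then obtain j0 where j0: "\<And>i j. j \<ge> j0 i \<Longrightarrow> {l1..l2} \<subseteq> F (i + n * j)" by metis
  show ?thesis
  proof (intro exI allI impI)
    fix m assume m: "n * Max (j0 ` {..<n}) \<le> m"
    have "j0 (m mod n) \<le> Max (j0 ` {..<n})"
      using n by simp
    also have "\<dots> \<le> m div n"
      using m n by (simp add: less_eq_div_iff_mult_less_eq mult.commute)
    finally show "{l1..l2} \<subseteq> F m"
      using j0[of "m mod n" "m div n"] by simp
  qed
qed


end

section \<open>From the same-side condition to covering\<close>

context interval_map
begin

theorem same_side_imp_eventually_covers: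
  assumes ss: "transitive_with_same_side_point I f"
  shows "eventually_covers_compact_intervals I f"
  unfolding eventually_covers_compact_intervals_def
proof (intro allI impI)
  fix K L
  assume KL: "nondeg_interval K \<and> compact K \<and> K \<subseteq> I \<and>
    nondeg_interval L \<and> compact L \<and> L \<subseteq> interior I"
  have tr: "transitive_on I f"
    using ss unfolding transitive_with_same_side_point_def by blast
  obtain x y where xy: "x \<in> K" "y \<in> K" "x < y" "is_interval K"
    using KL unfolding nondeg_interval_def by blast
  then have xyK: "{x..y} \<subseteq> K"
    using mem_is_interval_1_I[of K x y] by auto
  \<comment> \<open>Searching the two halves separately yields two distinct periodic points; the
    product of their periods is a common one.\<close>
  define c where "c = (x + y) / 2"
  have c: "x < c" "c < y" using xy(3) by (auto simp: c_def)
  have sub: "{x<..<c} \<subseteq> {x..y}" "{c<..<y} \<subseteq> {x..y}" using c by auto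
  obtain p n where p: "p \<in> {x<..<c}" "n > 0" "(f ^^ n) p = p"
    using periodic_point_in_interval[OF tr c(1)] sub xyK KL by (metis order_trans)
  obtain q m where q: "q \<in> {c<..<y}" "m > 0" "(f ^^ m) q = q"
    using periodic_point_in_interval[OF tr c(2)] sub xyK KL by (metis order_trans)
  have pqK: "{p..q} \<subseteq> K" using p q xyK by auto
  interpret P: periodic_interval I f p q "n * m"
  proof
    show "(f ^^ (n * m)) p = p" "(f ^^ (n * m)) q = q"
      using periodic_funpow_mult[of n f p m] periodic_funpow_mult[of m f q n] p q
      by (simp_all add: mult.commute)
    show "transitive_on I f" by (rule tr)
    show "p < q" "n * m > 0" using p(1,2) q(1,2) by auto
    show "{p..q} \<subseteq> I" using pqK KL by blast
  qed
  have "is_interval L" "L \<noteq> {}" "compact L"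
    using KL unfolding nondeg_interval_def by auto
  then obtain l1 l2 where L: "L = {l1..l2}" "l1 \<le> l2"
    using connected_compact_interval_1[of L] by (auto simp: is_interval_connected_1)
  then have "l1 \<in> L" "l2 \<in> L"
    by auto
  then have l: "l1 \<in> interior I" "l2 \<in> interior I"
    using KL by auto
  obtain z u v where zuv: "z \<in> interior I" "f z = z" "u \<in> interior I" "v \<in> interior I"
    "z < u \<and> z < v \<or> u < z \<and> v < z" "f u < z" "z < f v"
    using same_side_crossing[OF ss] .
  obtain a b where "a < b" "\<And>i. {a<..<b} \<subseteq> P.J i"
    by (rule P.J_common_interval[OF zuv]) blast
  then obtain M where M: "\<And>m. m \<ge> M \<Longrightarrow> L \<subseteq> P.F m"
    using P.F_eventually_covers[OF _ _ l] L by metis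
  have "L \<subseteq> (f ^^ m) ` K" if "m \<ge> Suc M" for m
    using M[of m] that pqK unfolding P.F_def by fastforce
  then show "\<exists>M>0. \<forall>n\<ge>M. L \<subseteq> (f ^^ n) ` K"
    by blast
qed

end

section \<open>Mixing, weak mixing, iterates and residual sets\<close>

lemma nondeg_interval_Icc: "a < b \<Longrightarrow> nondeg_interval {a..b}"
  unfolding nondeg_interval_def
  by (intro conjI bexI[of _ a] bexI[of _ b]) (auto simp: is_interval_cc)

lemma funpow_map_prod:
  fixes f :: "'a \<Rightarrow> 'a" and g :: "'b \<Rightarrow> 'b"
  shows "(map_prod f g ^^ k) = map_prod (f ^^ k) (g ^^ k)"
  by (induction k) (auto simp: fun_eq_iff)

lemma Union_period_points:
  "(\<Union>n. period_points X g n) = {x \<in> X. \<exists>n>0. (g ^^ n) x = x}"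
proof -
  have "\<exists>n. x \<in> period_points X g n" if x: "x \<in> X" "n > 0" "(g ^^ n) x = x" for x n
  proof -
    let ?P = "\<lambda>n. n > 0 \<and> (g ^^ n) x = x"
    have "?P (LEAST n. ?P n)"
      using x by (intro LeastI[of ?P n]) simp
    moreover have "\<not> ?P i" if "i < (LEAST n. ?P n)" for i
      using not_less_Least that by blast
    ultimately show ?thesis
      using x(1) unfolding period_points_def by blast
  qed
  then have "{x \<in> X. \<exists>n>0. (g ^^ n) x = x} \<subseteq> (\<Union>n. period_points X g n)"
    by blast
  moreover have "(\<Union>n. period_points X g n) \<subseteq> {x \<in> X. \<exists>n>0. (g ^^ n) x = x}"
    unfolding period_points_def by blast
  ultimately show ?thesis by (rule equalityI[rotated])
qed

context interval_map
begin

text \<open>Every converse direction ends in this parity argument. The sides are closed because an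
  orbit may land on \<open>z\<close>.\<close>

lemma swap_funpow:
  assumes "\<forall>x\<in>I. (x \<le> z \<longrightarrow> z \<le> f x) \<and> (z \<le> x \<longrightarrow> f x \<le> z)"
    and x: "x \<in> I"
  shows "x \<le> z \<Longrightarrow> even j \<Longrightarrow> (f ^^ j) x \<le> z" "x \<le> z \<Longrightarrow> odd j \<Longrightarrow> z \<le> (f ^^ j) x"
    "z \<le> x \<Longrightarrow> even j \<Longrightarrow> z \<le> (f ^^ j) x" "z \<le> x \<Longrightarrow> odd j \<Longrightarrow> (f ^^ j) x \<le> z"
proof -
  have "(x \<le> z \<longrightarrow> (if even j then (f ^^ j) x \<le> z else z \<le> (f ^^ j) x)) \<and>
    (z \<le> x \<longrightarrow> (if even j then z \<le> (f ^^ j) x else (f ^^ j) x \<le> z))"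
  proof (induction j)
    case (Suc j)
    then show ?case
      using bspec[OF assms(1) funpow_in[OF x, of j]] by auto
  qed simp
  then show "x \<le> z \<Longrightarrow> even j \<Longrightarrow> (f ^^ j) x \<le> z" "x \<le> z \<Longrightarrow> odd j \<Longrightarrow> z \<le> (f ^^ j) x"
    "z \<le> x \<Longrightarrow> even j \<Longrightarrow> z \<le> (f ^^ j) x" "z \<le> x \<Longrightarrow> odd j \<Longrightarrow> (f ^^ j) x \<le> z"
    by auto
qed

lemma openin_sides:
  assumes "z \<in> interior I"
  shows "openin (top_of_set I) (I \<inter> {..<z})" "I \<inter> {..<z} \<noteq> {}"
    "openin (top_of_set I) (I \<inter> {z<..})" "I \<inter> {z<..} \<noteq> {}"
proof -
  obtain a b where "a < z" "z < b" "{a..b} \<subseteq> I" using interiorE[OF assms] .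
  then have "a \<in> I \<inter> {..<z}" "b \<in> I \<inter> {z<..}" by auto
  then show "I \<inter> {..<z} \<noteq> {}" "I \<inter> {z<..} \<noteq> {}" by blast+
qed (auto intro: openin_open_Int)

lemma covers_imp_mixing:
  assumes "eventually_covers_compact_intervals I f"
  shows "mixing_on I f"
  unfolding mixing_on_def
proof (intro allI impI)
  fix U V
  assume UV: "openin (top_of_set I) U \<and> U \<noteq> {} \<and> openin (top_of_set I) V \<and> V \<noteq> {}"
  obtain a b where ab: "a < b" "{a..b} \<subseteq> U" "{a..b} \<subseteq> interior I"
    using openin_interval_contains_interval[OF nondeg] UV by metis
  obtain c d where cd: "c < d" "{c..d} \<subseteq> V" "{c..d} \<subseteq> interior I"
    using openin_interval_contains_interval[OF nondeg] UV by metis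
  have "nondeg_interval {a..b}" "nondeg_interval {c..d}"
    using ab(1) cd(1) nondeg_interval_Icc by auto
  moreover have "{a..b} \<subseteq> I"
    using ab(3) interior_subset by blast
  ultimately obtain M where M: "M > 0" "\<forall>n\<ge>M. {c..d} \<subseteq> (f ^^ n) ` {a..b}"
    using assms cd(3) unfolding eventually_covers_compact_intervals_def by (meson compact_Icc)
  have "c \<in> {c..d}" using cd(1) by simp
  then have "c \<in> (f ^^ n) ` U \<inter> V" if "n \<ge> M" for n
    using M(2)[rule_format, OF that] cd(2) image_mono[OF ab(2), of "f ^^ n"] by (meson IntI subsetD)
  then show "\<exists>m>0. \<forall>n\<ge>m. (f ^^ n) ` U \<inter> V \<noteq> {}"
    using M(1) by (metis empty_iff)
qed

lemma mixing_imp_totally_transitive: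
  assumes "mixing_on I f"
  shows "totally_transitive_on I f"
  unfolding totally_transitive_on_def transitive_on_def
proof (intro allI impI)
  fix k :: nat and U V
  assume k: "1 \<le> k" and "openin (top_of_set I) U \<and> U \<noteq> {} \<and> openin (top_of_set I) V \<and> V \<noteq> {}"
  then obtain m where m: "m > 0" "\<And>n. n \<ge> m \<Longrightarrow> (f ^^ n) ` U \<inter> V \<noteq> {}"
    using assms unfolding mixing_on_def by metis
  have "m \<le> k * m" using k by simp
  then show "\<exists>j>0. ((f ^^ k) ^^ j) ` U \<inter> V \<noteq> {}"
    using m unfolding funpow_mult by blast
qed

lemma totally_transitive_imp_even_iterate:
  "totally_transitive_on I f \<Longrightarrow> even_iterate_transitive I f"
  unfolding totally_transitive_on_def even_iterate_transitive_def
  by (intro exI[of _ 1]) simp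

lemma even_iterate_imp_same_side:
  assumes "even_iterate_transitive I f"
  shows "transitive_with_same_side_point I f"
proof (rule ccontr)
  assume no: "\<not> transitive_with_same_side_point I f"
  obtain k where k: "k > 0" and tr: "transitive_on I (f ^^ (2 * k))"
    using assms unfolding even_iterate_transitive_def by blast
  have trans: "\<exists>j>0. (f ^^ (2 * k * j)) ` U \<inter> V \<noteq> {}"
    if "openin (top_of_set I) U" "U \<noteq> {}" "openin (top_of_set I) V" "V \<noteq> {}" for U V
    using tr[unfolded transitive_on_def funpow_mult, rule_format, of U V] that by blast
  have "transitive_on I f"
    unfolding transitive_on_def
  proof (intro allI impI)
    fix U V
    assume "openin (top_of_set I) U \<and> U \<noteq> {} \<and> openin (top_of_set I) V \<and> V \<noteq> {}"
    then obtain j where "j > 0" "(f ^^ (2 * k * j)) ` U \<inter> V \<noteq> {}"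
      using trans[of U V] by blast
    then show "\<exists>k>0. (f ^^ k) ` U \<inter> V \<noteq> {}"
      using k by (intro exI[of _ "2 * k * j"]) simp
  qed
  then obtain z where z: "z \<in> interior I" "f z = z" and
    swap: "\<forall>x\<in>I. (x \<le> z \<longrightarrow> z \<le> f x) \<and> (z \<le> x \<longrightarrow> f x \<le> z)"
    by (rule not_same_side_swap[OF _ no])
  obtain j where "(f ^^ (2 * k * j)) ` (I \<inter> {..<z}) \<inter> (I \<inter> {z<..}) \<noteq> {}"
    using trans[OF openin_sides[OF z(1)]] by blast
  then obtain x where x: "x \<in> I" "x < z" "z < (f ^^ (2 * k * j)) x"
    by auto
  have "(f ^^ (2 * k * j)) x \<le> z"
    by (rule swap_funpow(1)[OF swap]) (use x in auto)
  then show False using x(3) by simp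
qed

lemma mixing_imp_weakly_mixing:
  assumes "mixing_on I f"
  shows "weakly_mixing_on I f"
  unfolding weakly_mixing_on_def transitive_on_def
proof (intro allI impI)
  have box: "\<exists>A B. openin (top_of_set I) A \<and> openin (top_of_set I) B \<and> A \<noteq> {} \<and> B \<noteq> {} \<and> A \<times> B \<subseteq> U"
    if U: "openin (top_of_set (I \<times> I)) U" "U \<noteq> {}" for U
  proof -
    obtain T where T: "open T" "U = (I \<times> I) \<inter> T"
      using U(1) openin_open by metis
    obtain x y where xy: "(x, y) \<in> U" using U(2) by auto
    then obtain A B where AB: "open A" "open B" "(x, y) \<in> A \<times> B" "A \<times> B \<subseteq> T"
      using open_prod_elim[OF T(1), of "(x, y)"] T(2) by blast
    have "(I \<inter> A) \<times> (I \<inter> B) \<subseteq> U" "x \<in> I \<inter> A" "y \<in> I \<inter> B"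
      using xy AB T(2) by auto
    then show ?thesis
      using openin_open_Int[OF AB(1)] openin_open_Int[OF AB(2)] by blast
  qed
  fix U V
  assume UV: "openin (top_of_set (I \<times> I)) U \<and> U \<noteq> {} \<and> openin (top_of_set (I \<times> I)) V \<and> V \<noteq> {}"
  obtain A B where AB: "openin (top_of_set I) A" "openin (top_of_set I) B" "A \<noteq> {}" "B \<noteq> {}" "A \<times> B \<subseteq> U"
    using box[of U] UV by blast
  obtain A' B' where AB': "openin (top_of_set I) A'" "openin (top_of_set I) B'" "A' \<noteq> {}" "B' \<noteq> {}"
      "A' \<times> B' \<subseteq> V"
    using box[of V] UV by blast
  obtain m where m: "m > 0" "\<And>n. n \<ge> m \<Longrightarrow> (f ^^ n) ` A \<inter> A' \<noteq> {}"
    using assms AB(1,3) AB'(1,3) unfolding mixing_on_def by metis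
  obtain m' where m': "m' > 0" "\<And>n. n \<ge> m' \<Longrightarrow> (f ^^ n) ` B \<inter> B' \<noteq> {}"
    using assms AB(2,4) AB'(2,4) unfolding mixing_on_def by metis
  obtain x where x: "x \<in> A" "(f ^^ (m + m')) x \<in> A'" using m(2)[of "m + m'"] by auto
  obtain y where y: "y \<in> B" "(f ^^ (m + m')) y \<in> B'" using m'(2)[of "m + m'"] by auto
  have "(map_prod f f ^^ (m + m')) (x, y) \<in> V"
    unfolding funpow_map_prod using x y AB' by auto
  moreover have "(x, y) \<in> U" using x y AB by auto
  ultimately show "\<exists>k>0. (map_prod f f ^^ k) ` U \<inter> V \<noteq> {}"
    using m(1) by (intro exI[of _ "m + m'"]) auto
qed

lemma weakly_mixing_imp_same_side:
  assumes "weakly_mixing_on I f"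
  shows "transitive_with_same_side_point I f"
proof (rule ccontr)
  assume no: "\<not> transitive_with_same_side_point I f"
  have trans: "\<exists>k>0. \<exists>x\<in>A. \<exists>y\<in>B. (f ^^ k) x \<in> A' \<and> (f ^^ k) y \<in> B'"
    if "openin (top_of_set I) A" "A \<noteq> {}" "openin (top_of_set I) B" "B \<noteq> {}"
       "openin (top_of_set I) A'" "A' \<noteq> {}" "openin (top_of_set I) B'" "B' \<noteq> {}" for A B A' B'
  proof -
    have "openin (top_of_set (I \<times> I)) (A \<times> B)" "openin (top_of_set (I \<times> I)) (A' \<times> B')"
      "A \<times> B \<noteq> {}" "A' \<times> B' \<noteq> {}"
      using that by (auto intro: openin_Times)
    then obtain k where "k > 0" "(map_prod f f ^^ k) ` (A \<times> B) \<inter> (A' \<times> B') \<noteq> {}"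
      using assms unfolding weakly_mixing_on_def transitive_on_def by metis
    then show ?thesis
      unfolding funpow_map_prod by auto
  qed
  have "transitive_on I f"
    unfolding transitive_on_def
  proof (intro allI impI)
    fix U V
    assume UV: "openin (top_of_set I) U \<and> U \<noteq> {} \<and> openin (top_of_set I) V \<and> V \<noteq> {}"
    then show "\<exists>k>0. (f ^^ k) ` U \<inter> V \<noteq> {}"
      using trans[of U U V V] by blast
  qed
  then obtain z where z: "z \<in> interior I" "f z = z" and
    swap: "\<forall>x\<in>I. (x \<le> z \<longrightarrow> z \<le> f x) \<and> (z \<le> x \<longrightarrow> f x \<le> z)"
    by (rule not_same_side_swap[OF _ no])
  \<comment> \<open>Two points left of \<open>z\<close> are sent to opposite sides at the same time
    \<open>k\<close>, which neither parity of \<open>k\<close> allows.\<close>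
  obtain k x y where "x \<in> I \<inter> {..<z}" "y \<in> I \<inter> {..<z}"
      "(f ^^ k) x \<in> I \<inter> {..<z}" "(f ^^ k) y \<in> I \<inter> {z<..}"
    using trans[of "I \<inter> {..<z}" "I \<inter> {..<z}" "I \<inter> {..<z}" "I \<inter> {z<..}"] openin_sides[OF z(1)] by blast
  then have xy: "x \<in> I" "x \<le> z" "y \<in> I" "y \<le> z" "(f ^^ k) x < z" "z < (f ^^ k) y"
    by auto
  show False
  proof (cases "even k")
    case True
    then show ?thesis using swap_funpow(1)[OF swap xy(3,4) True] xy(6) by simp
  next
    case False
    then show ?thesis using swap_funpow(2)[OF swap xy(1,2) False] xy(5) by simp
  qed
qed

lemma residual_imp_same_side:
  assumes "residual_dense_along_every_subsequence I f"
  shows "transitive_with_same_side_point I f"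
proof (rule ccontr)
  assume no: "\<not> transitive_with_same_side_point I f"
  have dense_orbits: "\<exists>S. dense_in I S \<and> (\<forall>x\<in>S. dense_in I {(f ^^ n) x |n. n \<in> M})"
    if "infinite M" "M \<subseteq> {1..}" for M
    using assms that unfolding residual_dense_along_every_subsequence_def by blast
  obtain S where S: "dense_in I S" "\<And>x. x \<in> S \<Longrightarrow> dense_in I {(f ^^ n) x |n. n \<in> {1..}}"
    using dense_orbits[of "{1..}"] infinite_Ici by blast
  have "transitive_on I f"
  proof (rule transitive_on_intervalI[OF nondeg])
    fix a b c d :: real
    assume ab: "a < b" "{a..b} \<subseteq> interior I" and cd: "c < d" "{c..d} \<subseteq> interior I"
    have sub: "{a<..<b} \<subseteq> I" "{c<..<d} \<subseteq> I"
      using ab cd interior_subset by fastforce+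
    obtain x where x: "x \<in> S" "x \<in> {a<..<b}"
      using S(1) ab(1) sub(1) unfolding dense_in_interval_iff[OF nondeg] by blast
    have "{(f ^^ n) x |n. n \<in> {1..}} \<inter> {c<..<d} \<noteq> {}"
      using S(2)[OF x(1)] cd(1) sub(2) unfolding dense_in_interval_iff[OF nondeg] by blast
    then obtain n where "n \<ge> 1" "(f ^^ n) x \<in> {c<..<d}"
      by blast
    then show "\<exists>k>0. \<exists>x\<in>{a..b}. (f ^^ k) x \<in> {c..d}"
      using x(2) by (intro exI[of _ n] conjI bexI[of _ x]) auto
  qed
  then obtain z where z: "z \<in> interior I" "f z = z" and
    swap: "\<forall>x\<in>I. (x \<le> z \<longrightarrow> z \<le> f x) \<and> (z \<le> x \<longrightarrow> f x \<le> z)"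
    by (rule not_same_side_swap[OF _ no])
  \<comment> \<open>At positive even times an orbit stays on its own side of \<open>z\<close>, so
    its points at these times cannot be dense.\<close>
  define M where "M = range (\<lambda>n::nat. 2 * n + 2)"
  have "infinite M"
    unfolding M_def by (rule range_inj_infinite) (auto simp: inj_on_def)
  then obtain S' where S': "dense_in I S'" "\<And>x. x \<in> S' \<Longrightarrow> dense_in I {(f ^^ n) x |n. n \<in> M}"
    using dense_orbits[of M] unfolding M_def by auto
  obtain a b where ab: "a < z" "z < b" "{a..b} \<subseteq> I" using interiorE[OF z(1)] .
  have sub: "{a<..<z} \<subseteq> I" "{z<..<b} \<subseteq> I"
    using ab by (auto simp: subset_iff)
  have "S' \<inter> {a<..<z} \<noteq> {}"
    using S'(1) ab(1) sub(1) unfolding dense_in_interval_iff[OF nondeg] by blast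
  then obtain x where x: "x \<in> S'" "x \<in> {a<..<z}" by blast
  then have x': "x < z" "x \<in> I" using sub(1) by auto
  have "{(f ^^ n) x |n. n \<in> M} \<inter> {z<..<b} \<noteq> {}"
    using S'(2)[OF x(1)] ab(2) sub(2) unfolding dense_in_interval_iff[OF nondeg] by blast
  then obtain n where "z < (f ^^ (2 * n + 2)) x" unfolding M_def by auto
  moreover have "(f ^^ (2 * n + 2)) x \<le> z"
    by (rule swap_funpow(1)[OF swap]) (use x' in auto)
  ultimately show False by simp
qed

text \<open>\<open>I\<close> may be neither open nor closed, so the Baire theorem is applied in a
  compact interval \<open>{c..d}\<close> inside the open interval to be met.\<close>

lemma Baire_interval:
  assumes G: "\<And>n::nat. openin (top_of_set I) (G n)" "\<And>n. dense_in I (G n)"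
  shows "dense_in I (\<Inter>n. G n)"
  unfolding dense_in_interval_iff[OF nondeg]
proof (intro conjI allI impI)
  show "(\<Inter>n. G n) \<subseteq> I" using G(2) unfolding dense_in_def by blast
  fix a b :: real assume ab: "a < b \<and> {a<..<b} \<subseteq> I"
  define c d where "c = (3 * a + b) / 4" and "d = (a + 3 * b) / 4"
  have cd: "a < c" "c < d" "d < b" using ab by (auto simp: c_def d_def)
  have sub: "{c..d} \<subseteq> {a<..<b}" using cd by auto
  have nd: "nondeg_interval {c..d}"
    using cd(2) by (rule nondeg_interval_Icc)
  have "{c..d} \<subseteq> closure (\<Inter>n. {c..d} \<inter> G n)"
  proof (rule Baire)
    fix T assume "T \<in> range (\<lambda>n. {c..d} \<inter> G n)"
    then obtain n where T: "T = {c..d} \<inter> G n" by blast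
    obtain T' where "open T'" "G n = I \<inter> T'" using G(1) openin_open by metis
    then have "T = {c..d} \<inter> T'" using T sub ab by blast
    then have "openin (top_of_set {c..d}) T" using \<open>open T'\<close> by (simp add: openin_open_Int)
    moreover have "dense_in {c..d} T"
      unfolding dense_in_interval_iff[OF nd]
    proof (intro conjI allI impI)
      fix a' b' assume *: "a' < b' \<and> {a'<..<b'} \<subseteq> {c..d}"
      then have "{a'<..<b'} \<subseteq> I" using sub ab by blast
      then show "T \<inter> {a'<..<b'} \<noteq> {}"
        using G(2)[of n] * T unfolding dense_in_interval_iff[OF nondeg] by blast
    qed (use T in blast)
    ultimately show "openin (top_of_set {c..d}) T \<and> {c..d} \<subseteq> closure T"
      unfolding dense_in_def by blast
  qed auto
  then have "closure (\<Inter>n. {c..d} \<inter> G n) \<noteq> {}" using cd(2) by force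
  then have "(\<Inter>n. {c..d} \<inter> G n) \<noteq> {}" by (metis closure_empty)
  then show "(\<Inter>n. G n) \<inter> {a<..<b} \<noteq> {}" using sub by blast
qed

lemma mixing_imp_residual:
  assumes mix: "mixing_on I f"
  shows "residual_dense_along_every_subsequence I f"
  unfolding residual_dense_along_every_subsequence_def
proof (intro allI impI)
  fix M :: "nat set" assume M: "infinite M \<and> M \<subseteq> {1..}"
  obtain \<B> :: "real set set" where B: "countable \<B>" "topological_basis \<B>"
    using ex_countable_basis by blast
  have "\<B> \<noteq> {}"
    using B(2) topological_basisE[of \<B> UNIV 0] by blast
  define V where "V n = from_nat_into \<B> n" for n
  have V_open: "open (V n)" for n
    unfolding V_def by (metis B(2) \<open>\<B> \<noteq> {}\<close> from_nat_into topological_basis_open)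
  \<comment> \<open>The points whose orbit visits the \<open>n\<close>-th basis set at some time in
    \<open>M\<close>. A basis set that misses \<open>I\<close> imposes no condition, hence the value
    \<open>I\<close>.\<close>
  define G where "G n = (if I \<inter> V n = {} then I else (\<Union>m\<in>M. I \<inter> (f ^^ m) -` V n))" for n
  have G_open: "openin (top_of_set I) (G n)" for n
  proof -
    have "openin (top_of_set I) (\<Union>m\<in>M. I \<inter> (f ^^ m) -` V n)"
      by (rule openin_Union) (use continuous_openin_preimage_gen[OF continuous_on_funpow V_open] in blast)
    then show ?thesis unfolding G_def by simp
  qed
  have G_dense: "dense_in I (G n)" for n
    unfolding dense_in_interval_iff[OF nondeg]
  proof (intro conjI allI impI)
    show "G n \<subseteq> I" unfolding G_def by auto
    fix a b :: real assume ab: "a < b \<and> {a<..<b} \<subseteq> I"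
    show "G n \<inter> {a<..<b} \<noteq> {}"
    proof (cases "I \<inter> V n = {}")
      case True
      have "(a + b) / 2 \<in> {a<..<b}" using ab by auto
      moreover have "G n = I" using True unfolding G_def by simp
      ultimately show ?thesis using ab by blast
    next
      case False
      have "openin (top_of_set I) {a<..<b}" "{a<..<b} \<noteq> {}" "openin (top_of_set I) (I \<inter> V n)"
        using ab V_open by (auto intro: open_subset openin_open_Int)
      then obtain k where k: "\<And>m. m \<ge> k \<Longrightarrow> (f ^^ m) ` {a<..<b} \<inter> (I \<inter> V n) \<noteq> {}"
        using mix False unfolding mixing_on_def by metis
      obtain m where "m \<in> M" "m \<ge> k"
        using M by (meson infinite_nat_iff_unbounded_le)
      then show ?thesis
        using k[of m] ab False unfolding G_def by auto
    qed
  qed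
  define S where "S = (\<Inter>n. G n)"
  have "dense_in I S"
    unfolding S_def using G_open G_dense by (rule Baire_interval)
  moreover have "residual_in I S"
    unfolding residual_in_def
  proof (intro conjI exI[of _ G] allI)
    show "S \<subseteq> I" using calculation unfolding dense_in_def by (rule conjunct1)
  qed (simp_all add: G_open G_dense S_def)
  moreover have "dense_in I {(f ^^ n) x |n. n \<in> M}" if x: "x \<in> S" for x
    unfolding dense_in_interval_iff[OF nondeg]
  proof (intro conjI allI impI)
    have "x \<in> I" using x \<open>dense_in I S\<close> unfolding dense_in_def by blast
    then show "{(f ^^ n) x |n. n \<in> M} \<subseteq> I" using funpow_in by blast
    fix a b :: real assume ab: "a < b \<and> {a<..<b} \<subseteq> I"
    then have m: "(a + b) / 2 \<in> {a<..<b}" by auto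
    obtain W where W: "W \<in> \<B>" "(a + b) / 2 \<in> W" "W \<subseteq> {a<..<b}"
      using topological_basisE[OF B(2) open_greaterThanLessThan m] .
    obtain n where n: "W = V n"
      using W(1) B(1) unfolding V_def by (metis from_nat_into_surj)
    have "I \<inter> V n \<noteq> {}" using n W m ab by blast
    moreover have "x \<in> G n" using x unfolding S_def by blast
    ultimately obtain k where "k \<in> M" "(f ^^ k) x \<in> V n"
      unfolding G_def by auto
    then show "{(f ^^ n) x |n. n \<in> M} \<inter> {a<..<b} \<noteq> {}"
      using n W(3) by blast
  qed
  ultimately show "\<exists>S. residual_in I S \<and> dense_in I S \<and> (\<forall>x\<in>S. dense_in I {(f ^^ n) x |n. n \<in> M})"
    by blast
qed

section \<open>Simultaneous covering\<close>

text \<open>The preimage in \<open>K\<close> of an open part of \<open>L\<close> is relatively open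
  and, by the covering, nonempty; any short enough interval inside it will do.\<close>

lemma small_subinterval:
  assumes K: "nondeg_interval K" "K \<subseteq> I" and L: "nondeg_interval L" "L \<subseteq> (f ^^ n) ` K" and "\<epsilon> > 0"
  shows "\<exists>K'. nondeg_interval K' \<and> compact K' \<and> K' \<subseteq> K \<and> diameter K' < \<epsilon> \<and> (f ^^ n) ` K' \<subseteq> L"
proof -
  obtain l1 l2 where l: "l1 \<in> L" "l2 \<in> L" "l1 < l2" "is_interval L"
    using L(1) unfolding nondeg_interval_def by blast
  have sub: "{l1<..<l2} \<subseteq> L"
    using l mem_is_interval_1_I[OF l(4,1,2)] by auto
  have "openin (top_of_set K) (K \<inter> (f ^^ n) -` {l1<..<l2})"
    using continuous_on_subset[OF continuous_on_funpow K(2)] continuous_openin_preimage_gen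
      open_greaterThanLessThan by blast
  moreover have "K \<inter> (f ^^ n) -` {l1<..<l2} \<noteq> {}"
  proof -
    have "(l1 + l2) / 2 \<in> {l1<..<l2}" using l(3) by auto
    moreover from this have "(l1 + l2) / 2 \<in> (f ^^ n) ` K" using sub L(2) by blast
    ultimately show ?thesis by auto
  qed
  ultimately obtain a b where ab: "a < b" "{a..b} \<subseteq> K \<inter> (f ^^ n) -` {l1<..<l2}"
    using openin_interval_contains_interval[OF K(1)] by metis
  define c where "c = min b (a + \<epsilon> / 2)"
  have c: "a < c" "c \<le> b" "c - a < \<epsilon>"
    using ab(1) \<open>\<epsilon> > 0\<close> by (auto simp: c_def min_def)
  have sub': "{a..c} \<subseteq> {a..b}" using c by auto
  show ?thesis
  proof (intro exI conjI)
    show "nondeg_interval {a..c}"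
      using c(1) by (rule nondeg_interval_Icc)
    show "diameter {a..c} < \<epsilon>" using c by (simp add: diameter_closed_interval)
    show "{a..c} \<subseteq> K" "(f ^^ n) ` {a..c} \<subseteq> L" using ab(2) sub' sub by blast+
  qed simp
qed

lemma covers_imp_simultaneous:
  assumes cov: "eventually_covers_compact_intervals I f"
  shows "simultaneous_covering I f"
  unfolding simultaneous_covering_def
proof (intro allI impI)
  fix m :: nat and K V L
  assume *: "m > 0 \<and> (\<forall>i\<in>{1..m}. nondeg_interval (K i) \<and> compact (K i) \<and> K i \<subseteq> I \<and>
    nondeg_interval (V i) \<and> V i \<subseteq> I \<and>
    nondeg_interval (L i) \<and> compact (L i) \<and> L i \<subseteq> interior (V i))"
  have "\<exists>M. \<forall>n\<ge>M. L i \<subseteq> (f ^^ n) ` K i" if i: "i \<in> {1..m}" for i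
  proof -
    have "L i \<subseteq> interior I"
      using * i interior_mono by blast
    then show ?thesis
      using cov[unfolded eventually_covers_compact_intervals_def, rule_format, of "K i" "L i"] * i by blast
  qed
  then obtain M where M: "\<And>i n. i \<in> {1..m} \<Longrightarrow> n \<ge> M i \<Longrightarrow> L i \<subseteq> (f ^^ n) ` K i"
    by metis
  define N where "N = Suc (Max (M ` {1..m}))"
  have N: "M i \<le> N" if "i \<in> {1..m}" for i
    unfolding N_def using that by (simp add: le_SucI)
  show "\<exists>N>0. \<forall>i\<in>{1..m}. \<forall>n\<ge>N. L i \<subseteq> (f ^^ n) ` K i \<and>
    (\<forall>\<epsilon>>0. \<exists>K'. nondeg_interval K' \<and> compact K' \<and> K' \<subseteq> K i \<and> diameter K' < \<epsilon> \<and> (f ^^ n) ` K' \<subseteq> L i)"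
  proof (intro exI[of _ N] conjI ballI allI impI)
    fix i n assume i: "i \<in> {1..m}" and n: "N \<le> n"
    show L: "L i \<subseteq> (f ^^ n) ` K i"
      using M[OF i] N[OF i] n by simp
    fix \<epsilon> :: real assume "\<epsilon> > 0"
    then show "\<exists>K'. nondeg_interval K' \<and> compact K' \<and> K' \<subseteq> K i \<and> diameter K' < \<epsilon> \<and> (f ^^ n) ` K' \<subseteq> L i"
      using small_subinterval[OF _ _ _ L] * i by blast
  qed (simp add: N_def)
qed

end

section \<open>Itineraries and points of exact period\<close>

text \<open>Between the last visit to \<open>e1\<close> and the first later visit to \<open>e2\<close> the values stay in \<open>{e1..e2}\<close>.\<close>
lemma exact_subinterval_increasing:
  fixes g :: "real \<Rightarrow> real"
  assumes cont: "continuous_on {u..v} g" and uv: "u \<le> v" "g u = e1" "g v = e2" "e1 \<le> e2"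
  shows "\<exists>c d. c \<le> d \<and> {c..d} \<subseteq> {u..v} \<and> g ` {c..d} = {e1..e2}"
proof -
  let ?A = "{t \<in> {u..v}. g t = e1}"
  have "compact ?A"
    using continuous_closed_preimage_constant[OF cont closed_atLeastAtMost]
    by (auto simp: compact_eq_bounded_closed intro: bounded_subset[OF bounded_closed_interval[of u v]])
  moreover have "u \<in> ?A" using uv by auto
  ultimately obtain c where c: "c \<in> ?A" "\<And>t. t \<in> ?A \<Longrightarrow> t \<le> c"
    using compact_attains_sup[of ?A] by blast
  let ?B = "{t \<in> {c..v}. g t = e2}"
  have cont_c: "continuous_on {c..v} g"
    using cont c(1) by (auto intro: continuous_on_subset)
  have "compact ?B"
    using continuous_closed_preimage_constant[OF cont_c closed_atLeastAtMost]
    by (auto simp: compact_eq_bounded_closed intro: bounded_subset[OF bounded_closed_interval[of c v]])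
  moreover have "v \<in> ?B" using uv c(1) by auto
  ultimately obtain d where d: "d \<in> ?B" "\<And>t. t \<in> ?B \<Longrightarrow> d \<le> t"
    using compact_attains_inf[of ?B] by blast
  have cont_cd: "continuous_on {c..d} g"
    using cont_c d(1) by (auto intro: continuous_on_subset)
  have le: "c \<le> d" using d(1) by auto
  have "g t \<in> {e1..e2}" if t: "t \<in> {c..d}" for t
  proof (rule ccontr)
    assume "g t \<notin> {e1..e2}"
    then consider "g t < e1" | "e2 < g t" by force
    then show False
    proof cases
      case 1
      have "continuous_on {t..d} g" using cont_cd t by (auto intro: continuous_on_subset)
      then obtain s where s: "t \<le> s" "s \<le> d" "g s = e1"
        using IVT'[of g t e1 d] 1 uv d(1) t by auto
      then have "s \<le> c" using c d(1) t by auto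
      then have "t = c" using s t by auto
      then show False using 1 c(1) by auto
    next
      case 2
      have "continuous_on {c..t} g" using cont_cd t by (auto intro: continuous_on_subset)
      then obtain s where s: "c \<le> s" "s \<le> t" "g s = e2"
        using IVT'[of g c e2 t] 2 uv c(1) t by auto
      then have "d \<le> s" using d t by auto
      then have "t = d" using s t by auto
      then show False using 2 d(1) by auto
    qed
  qed
  moreover have "{e1..e2} \<subseteq> g ` {c..d}"
  proof
    fix y assume "y \<in> {e1..e2}"
    then obtain s where "c \<le> s" "s \<le> d" "g s = y"
      using IVT'[of g c y d] c(1) d(1) le cont_cd by auto
    then show "y \<in> g ` {c..d}" by auto
  qed
  ultimately have "g ` {c..d} = {e1..e2}" by blast
  moreover have "{c..d} \<subseteq> {u..v}" using c(1) d(1) by auto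
  ultimately show ?thesis using le by blast
qed

text \<open>Images that are exactly the next interval, and not merely cover it, are what lets
  itineraries be composed. If \<open>e2\<close> is attained to the left of \<open>e1\<close>, the
  increasing case is applied to \<open>- g\<close>.\<close>

lemma exact_subinterval:
  fixes g :: "real \<Rightarrow> real"
  assumes cont: "continuous_on {c1..c2} g" and E: "e1 \<le> e2" "{e1..e2} \<subseteq> g ` {c1..c2}"
  obtains d1 d2 where "d1 \<le> d2" "{d1..d2} \<subseteq> {c1..c2}" "g ` {d1..d2} = {e1..e2}"
proof -
  have "e1 \<in> g ` {c1..c2}" "e2 \<in> g ` {c1..c2}" using E by auto
  then obtain u v where uv: "u \<in> {c1..c2}" "g u = e1" "v \<in> {c1..c2}" "g v = e2"
    by blast
  show ?thesis
  proof (cases "u \<le> v")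
    case True
    have "{u..v} \<subseteq> {c1..c2}" using uv by auto
    then show ?thesis
      using exact_subinterval_increasing[of u v g e1 e2] continuous_on_subset[OF cont] True uv E(1) that
      by (metis order_trans)
  next
    case False
    have sub: "{v..u} \<subseteq> {c1..c2}" using uv by auto
    have "continuous_on {v..u} (\<lambda>t. - g t)"
      by (intro continuous_intros continuous_on_subset[OF cont sub])
    then obtain d1 d2 where d: "d1 \<le> d2" "{d1..d2} \<subseteq> {v..u}" "(\<lambda>t. - g t) ` {d1..d2} = {- e2..- e1}"
      using exact_subinterval_increasing[of v u "\<lambda>t. - g t" "- e2" "- e1"] False uv E(1) by auto
    have "g ` {d1..d2} = uminus ` (\<lambda>t. - g t) ` {d1..d2}"
      by (simp add: image_image)
    then have "g ` {d1..d2} = {e1..e2}" using d(3) by simp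
    then show ?thesis using that d sub by blast
  qed
qed

text \<open>With \<open>t = n / j\<close> and \<open>t' = n / j'\<close> the gap is
  \<open>n (j - j') / (j j')\<close>, which is at least \<open>n / J^2\<close> and so at least
  \<open>s\<close>. The proof multiplies by \<open>j'\<close> to stay within the naturals.\<close>

lemma separated_by_dividing:
  fixes n s J j j' t t' :: nat
  assumes "J * J * s \<le> n" "t * j = n" "t' * j' = n" "j \<le> J" "j' \<le> J" "0 < j" "0 < J" "t < t'" "0 < n"
  shows "t + s \<le> t'"
proof -
  have "j' < j"
  proof (rule ccontr)
    assume "\<not> j' < j"
    then have "t * j \<le> t * j'" by simp
    moreover have "t * j' < t' * j' \<or> j' = 0" using assms(8) by auto
    ultimately have "t * j < t' * j' \<or> j' = 0" by linarith
    then show False using assms \<open>\<not> j' < j\<close> by auto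
  qed
  then have "t * (j' + 1) \<le> t * j" by (intro mult_le_mono2) simp
  then have le: "t * j' + t \<le> t' * j'" using assms by simp
  have "J * (J * s) \<le> t * j" using assms by (simp add: mult.assoc)
  also have "\<dots> \<le> t * J" using assms(4) by (rule mult_le_mono2)
  finally have "J * s \<le> t" using assms(7) by (simp add: mult.commute)
  moreover have "j' * s \<le> J * s" using assms(5) by (rule mult_le_mono1)
  ultimately have "t * j' + j' * s \<le> t' * j'" using le by linarith
  then have "(t + s) * j' \<le> t' * j'" by (simp add: algebra_simps)
  moreover have "j' > 0"
    using assms by (cases j') auto
  ultimately show ?thesis by simp
qed

text \<open>The divisors \<open>n div j\<close> of \<open>n\<close> with small \<open>j\<close> are far apart; every other proper divisor is so
  small that it has a multiple among the multiples of \<open>s\<close> between \<open>n / 2 + s\<close> and \<open>n - s\<close>.\<close>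
lemma separated_times_meeting_divisors:
  fixes s n :: nat
  assumes s: "0 < s" and n: "16 * s ^ 3 \<le> n" "8 * s \<le> n"
  obtains T where "finite T" "\<And>t. t \<in> T \<Longrightarrow> s \<le> t \<and> t + s \<le> n"
    "\<And>t t'. t \<in> T \<Longrightarrow> t' \<in> T \<Longrightarrow> t < t' \<Longrightarrow> t + s \<le> t'"
    "\<And>d. d dvd n \<Longrightarrow> 0 < d \<Longrightarrow> d < n \<Longrightarrow> \<exists>k. d * k \<in> T"
proof -
  \<comment> \<open>If \<open>d = n / j\<close> with \<open>j\<close> above this threshold, then
    \<open>d * s\<close> is at most \<open>n / 4\<close>. With this value \<open>J * J * s\<close>
    is the bound \<open>16 * s ^ 3\<close> that separates the times in \<open>A\<close>.\<close>
  define J where "J = 4 * s"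
  define A where "A = {t. \<exists>j. 2 \<le> j \<and> j \<le> J \<and> t * j = n}"
  define B where "B = {t. s dvd t \<and> n + 2 * s \<le> 2 * t \<and> t + s \<le> n}"
  have "J * J * s = 16 * s ^ 3"
    unfolding J_def power3_eq_cube by simp
  then have J: "J * J * s \<le> n" "0 < J"
    using n(1) s by (simp_all add: J_def)
  have A_half: "2 * t \<le> n" if t: "t \<in> A" for t
  proof -
    obtain j where "2 \<le> j" "t * j = n" using t unfolding A_def by blast
    then show ?thesis using mult_le_mono2[of 2 j t] by simp
  qed
  have A_ge: "s \<le> t" if t: "t \<in> A" for t
  proof -
    obtain j where j: "j \<le> J" "t * j = n" using t unfolding A_def by blast
    then have "n \<le> t * J" using mult_le_mono2[of j J t] by simp
    with J(1) have "J * J * s \<le> t * J" by (rule order_trans)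
    then have "J * (J * s) \<le> J * t" by (simp only: mult_ac)
    then have "J * s \<le> t" using J(2) by simp
    moreover have "s \<le> J * s" using J(2) by simp
    ultimately show ?thesis by linarith
  qed
  show ?thesis
  proof (rule that[of "A \<union> B"])
    have "A \<union> B \<subseteq> {..n}" using A_half unfolding B_def by fastforce
    then show "finite (A \<union> B)" by (rule finite_subset) simp
    show "s \<le> t \<and> t + s \<le> n" if "t \<in> A \<union> B" for t
      using that
    proof
      assume "t \<in> A"
      then show ?thesis using A_half A_ge n(2) by fastforce
    next
      assume "t \<in> B"
      then show ?thesis using n(2) unfolding B_def by auto
    qed
    show "t + s \<le> t'" if tt: "t \<in> A \<union> B" "t' \<in> A \<union> B" "t < t'" for t t'
    proof -
      consider "t \<in> A" "t' \<in> A" | "t \<in> A" "t' \<in> B" | "t \<in> B" "t' \<in> A" | "t \<in> B" "t' \<in> B"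
        using tt by blast
      then show ?thesis
      proof cases
        case 1
        then obtain j j' where "2 \<le> j" "j \<le> J" "t * j = n" "j' \<le> J" "t' * j' = n"
          unfolding A_def by blast
        then show ?thesis using separated_by_dividing[OF J(1), of t j t' j'] J(2) tt(3) s n(2) by simp
      next
        case 2
        then show ?thesis using A_half[of t] unfolding B_def by auto
      next
        case 3
        then show ?thesis using A_half[of t'] s tt(3) unfolding B_def by auto
      next
        case 4
        then obtain i i' where "t = s * i" "t' = s * i'" unfolding B_def by (auto elim!: dvdE)
        then show ?thesis
          using tt(3) s mult_le_mono2[of "i + 1" i' s] by (simp add: algebra_simps)
      qed
    qed
    show "\<exists>k. d * k \<in> A \<union> B" if d: "d dvd n" "0 < d" "d < n" for d
    proof -
      obtain j where j: "n = d * j" using d(1) by blast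
      then have "2 \<le> j" using d by (cases j; cases "j - 1") auto
      show ?thesis
      proof (cases "j \<le> J")
        case True
        then have "d * 1 \<in> A" unfolding A_def using j \<open>2 \<le> j\<close> by auto
        then show ?thesis by blast
      next
        case False
        \<comment> \<open>A common multiple of \<open>d\<close> and \<open>s\<close>: its multiples
          are multiples of \<open>d\<close> and lie in the grid that defines
          \<open>B\<close>.\<close>
        define w where "w = d * s"
        have "d * J \<le> d * j" using False by simp
        then have w: "4 * w \<le> n" "0 < w"
          using j d s by (simp_all add: w_def J_def algebra_simps)
        \<comment> \<open>\<open>w * k\<close> is the first multiple of \<open>w\<close> above
          \<open>n / 2 + s\<close>. It overshoots by at most \<open>n / 4\<close>, and
          \<open>8 * s \<le> n\<close> then keeps it below \<open>n - s\<close>.\<close>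
        define k where "k = (n + 2 * s) div (2 * w) + 1"
        have "(n + 2 * s) div (2 * w) * (2 * w) \<le> n + 2 * s" by simp
        then have up: "2 * (w * k) \<le> n + 2 * s + 2 * w"
          unfolding k_def by (simp add: algebra_simps)
        have "n + 2 * s < (n + 2 * s) div (2 * w) * (2 * w) + 2 * w"
          using w(2) by (metis add_mono_thms_linordered_field(4) div_mult_mod_eq
              mod_less_divisor nat_add_left_cancel_less mult_pos_pos zero_less_numeral)
        then have lo: "n + 2 * s \<le> 2 * (w * k)"
          unfolding k_def by (simp add: algebra_simps)
        have "w * k \<in> B"
          using up lo w(1) n(2) unfolding B_def by (auto simp: w_def)
        then have "d * (s * k) \<in> B" by (simp add: w_def mult.assoc)
        then show ?thesis by blast
      qed
    qed
  qed
qed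

text \<open>The least positive return time of \<open>x\<close> divides \<open>n\<close>, so only
  proper divisors have to be excluded.\<close>

lemma least_period_of_avoiding:
  assumes "0 < n" "(g ^^ n) x = x" and avoid: "\<And>d. d dvd n \<Longrightarrow> 0 < d \<Longrightarrow> d < n \<Longrightarrow> (g ^^ d) x \<noteq> x"
    and "0 < i" "i < n"
  shows "(g ^^ i) x \<noteq> x"
proof
  assume i: "(g ^^ i) x = x"
  let ?P = "\<lambda>d. 0 < d \<and> (g ^^ d) x = x"
  define d where "d = (LEAST d. ?P d)"
  have d: "?P d" unfolding d_def using assms(4) i by (intro LeastI[of ?P i]) simp
  have "d \<le> i" unfolding d_def using assms(4) i by (intro Least_le) simp
  have "(g ^^ (n mod d)) x = x"
    using funpow_mod_eq[of d g x n] d assms(2) by simp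
  then have "\<not> 0 < n mod d"
    using not_less_Least[of "n mod d" ?P] d unfolding d_def[symmetric] by auto
  then have "d dvd n" by (simp add: dvd_eq_mod_eq_0)
  then show False using avoid[of d] d \<open>d \<le> i\<close> assms(5) by simp
qed

context interval_map
begin

text \<open>Times are added in increasing order. Trimming \<open>{c..d}\<close> until its image at
  time \<open>b\<close> is exactly \<open>{e1..e2}\<close> turns its later images into images of
  \<open>{e1..e2}\<close>, which cover both intervals again after \<open>s\<close> steps. The last
  conjunct records this; it allows the next visit and at the end the return to
  \<open>{k1..k2}\<close>.\<close>

lemma itinerary:
  assumes K: "k1 \<le> k2" "{k1..k2} \<subseteq> I" and E: "e1 \<le> e2" "{e1..e2} \<subseteq> I"
    and cov: "\<And>m. s \<le> m \<Longrightarrow> {k1..k2} \<union> {e1..e2} \<subseteq> (f ^^ m) ` {k1..k2}"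
      "\<And>m. s \<le> m \<Longrightarrow> {k1..k2} \<union> {e1..e2} \<subseteq> (f ^^ m) ` {e1..e2}"
    and "finite T" "\<forall>t\<in>T. s \<le> t" "\<forall>t\<in>T. \<forall>t'\<in>T. t < t' \<longrightarrow> t + s \<le> t'"
  shows "\<exists>c d. c \<le> d \<and> {c..d} \<subseteq> {k1..k2} \<and> (\<forall>t\<in>T. (f ^^ t) ` {c..d} \<subseteq> {e1..e2}) \<and>
    (\<forall>m. s \<le> m \<and> (\<forall>t\<in>T. t + s \<le> m) \<longrightarrow> {k1..k2} \<union> {e1..e2} \<subseteq> (f ^^ m) ` {c..d})"
  using \<open>finite T\<close> assms(8,9)
proof (induction T rule: finite_linorder_max_induct)
  case empty
  then show ?case using K(1) cov(1) by (intro exI[of _ k1] exI[of _ k2]) simp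
next
  case (insert b T)
  have "\<forall>t\<in>T. s \<le> t" "\<forall>t\<in>T. \<forall>t'\<in>T. t < t' \<longrightarrow> t + s \<le> t'"
    using insert.prems by blast+
  then obtain c d where cd: "c \<le> d" "{c..d} \<subseteq> {k1..k2}"
      "\<And>t. t \<in> T \<Longrightarrow> (f ^^ t) ` {c..d} \<subseteq> {e1..e2}"
      "\<And>m. s \<le> m \<Longrightarrow> \<forall>t\<in>T. t + s \<le> m \<Longrightarrow> {k1..k2} \<union> {e1..e2} \<subseteq> (f ^^ m) ` {c..d}"
    using insert.IH by metis
  have "{e1..e2} \<subseteq> (f ^^ b) ` {c..d}"
    using cd(4)[of b] insert by auto
  moreover have "continuous_on {c..d} (f ^^ b)"
    using continuous_on_subset[OF continuous_on_funpow] cd(2) K(2) by blast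
  ultimately obtain c' d' where cd': "c' \<le> d'" "{c'..d'} \<subseteq> {c..d}" "(f ^^ b) ` {c'..d'} = {e1..e2}"
    using exact_subinterval E(1) by metis
  have "(f ^^ t) ` {c'..d'} \<subseteq> {e1..e2}" if "t \<in> insert b T" for t
    using that
  proof
    assume "t \<in> T"
    then show ?thesis using cd(3) image_mono[OF cd'(2), of "f ^^ t"] by blast
  qed (use cd'(3) in simp)
  moreover have "{k1..k2} \<union> {e1..e2} \<subseteq> (f ^^ m) ` {c'..d'}" if m: "\<forall>t\<in>insert b T. t + s \<le> m" for m
  proof -
    have "m = (m - b) + b" "s \<le> m - b" using m by auto
    then have "(f ^^ m) ` {c'..d'} = (f ^^ (m - b)) ` {e1..e2}"
      using cd'(3) by (metis funpow_add image_comp)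
    then show ?thesis using cov(2)[OF \<open>s \<le> m - b\<close>] by simp
  qed
  ultimately show ?case
    using cd'(1) subset_trans[OF cd'(2) cd(2)]
    by (intro exI[of _ c'] exI[of _ d'] conjI ballI allI impI) simp_all
qed

lemma covers_imp_period_points:
  assumes cov: "eventually_covers_compact_intervals I f"
    and ab: "a < b" "{a..b} \<subseteq> interior I"
  shows "\<exists>m>0. \<forall>n\<ge>m. period_points I f n \<inter> {a..b} \<noteq> {}"
proof -
  \<comment> \<open>The itinerary starts in the left third of \<open>{a..b}\<close> and visits the
    right third. As these are disjoint, a visit at a multiple of \<open>d\<close> refutes that
    \<open>d\<close> is a period.\<close>
  define h where "h = (b - a) / 3"
  have h: "h > 0" "a + h < b - h" using ab(1) by (auto simp: h_def field_simps)
  have I: "{a..b} \<subseteq> I" using ab(2) interior_subset by blast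
  have sub: "{a..a + h} \<subseteq> {a..b}" "{b - h..b} \<subseteq> {a..b}" using h by auto
  have cov_ab: "\<exists>M>0. \<forall>n\<ge>M. {a..b} \<subseteq> (f ^^ n) ` {c..d}" if "c < d" "{c..d} \<subseteq> I" for c d
    using cov[unfolded eventually_covers_compact_intervals_def, rule_format, of "{c..d}" "{a..b}"]
      nondeg_interval_Icc ab that by simp
  obtain M where M: "M > 0" "\<And>n. n \<ge> M \<Longrightarrow> {a..b} \<subseteq> (f ^^ n) ` {a..a + h}"
    using cov_ab[OF _ subset_trans[OF sub(1) I]] h by auto
  obtain M' where M': "\<And>n. n \<ge> M' \<Longrightarrow> {a..b} \<subseteq> (f ^^ n) ` {b - h..b}"
    using cov_ab[OF _ subset_trans[OF sub(2) I]] h by auto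
  define s where "s = max M M'"
  have s: "s > 0" using M(1) by (simp add: s_def)
  have cover: "{a..a + h} \<union> {b - h..b} \<subseteq> (f ^^ n) ` {a..a + h}"
    "{a..a + h} \<union> {b - h..b} \<subseteq> (f ^^ n) ` {b - h..b}" if "s \<le> n" for n
    using M(2)[of n] M'[of n] that sub unfolding s_def by auto
  have "period_points I f n \<inter> {a..b} \<noteq> {}" if n: "n \<ge> 16 * s ^ 3 + 8 * s" for n
  proof -
    have "16 * s ^ 3 \<le> n" "8 * s \<le> n" using n by auto
    then obtain T where T: "finite T" "\<And>t. t \<in> T \<Longrightarrow> s \<le> t \<and> t + s \<le> n"
        "\<And>t t'. t \<in> T \<Longrightarrow> t' \<in> T \<Longrightarrow> t < t' \<Longrightarrow> t + s \<le> t'"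
        "\<And>d. d dvd n \<Longrightarrow> 0 < d \<Longrightarrow> d < n \<Longrightarrow> \<exists>k. d * k \<in> T"
      using separated_times_meeting_divisors[OF s] by metis
    have "\<exists>c d. c \<le> d \<and> {c..d} \<subseteq> {a..a + h} \<and> (\<forall>t\<in>T. (f ^^ t) ` {c..d} \<subseteq> {b - h..b}) \<and>
      (\<forall>m. s \<le> m \<and> (\<forall>t\<in>T. t + s \<le> m) \<longrightarrow> {a..a + h} \<union> {b - h..b} \<subseteq> (f ^^ m) ` {c..d})"
    proof (rule itinerary)
      show "{a..a + h} \<subseteq> I" "{b - h..b} \<subseteq> I" by (rule subset_trans[OF sub(1) I], rule subset_trans[OF sub(2) I])
      show "\<forall>t\<in>T. s \<le> t" "\<forall>t\<in>T. \<forall>t'\<in>T. t < t' \<longrightarrow> t + s \<le> t'" using T(2,3) by blast+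
    qed (use h cover T(1) in simp_all)
    then obtain c d where cd: "{c..d} \<subseteq> {a..a + h}"
        "\<forall>t\<in>T. (f ^^ t) ` {c..d} \<subseteq> {b - h..b}"
        "\<forall>m. s \<le> m \<and> (\<forall>t\<in>T. t + s \<le> m) \<longrightarrow> {a..a + h} \<union> {b - h..b} \<subseteq> (f ^^ m) ` {c..d}"
      by blast
    have "s \<le> n" using n s by simp
    then have "{a..a + h} \<subseteq> (f ^^ n) ` {c..d}" using cd(3) T(2) by simp
    moreover have "a \<in> {a..a + h}" "a + h \<in> {a..a + h}" using h(1) by auto
    ultimately have "a \<in> (f ^^ n) ` {c..d}" "a + h \<in> (f ^^ n) ` {c..d}" by blast+
    \<comment> \<open>Both points lie in \<open>{a..a + h}\<close>, and the \<open>n\<close>-th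
      iterate sends \<open>u\<close> to its left end and \<open>v\<close> to its right end, so a
      fixed point of this iterate lies between them.\<close>
    then obtain u v where uv: "u \<in> {c..d}" "(f ^^ n) u = a" "v \<in> {c..d}" "(f ^^ n) v = a + h"
      by (metis imageE)
    have cd_I: "{c..d} \<subseteq> I" using cd(1) sub I by blast
    have "u \<in> {a..a + h}" "v \<in> {a..a + h}" using uv(1,3) cd(1) by blast+
    then have "(f ^^ n) u \<le> u" "v \<le> (f ^^ n) v" using uv(2,4) by simp_all
    moreover have "u \<in> I" "v \<in> I" using uv(1,3) cd_I by blast+
    ultimately obtain x where x: "(f ^^ n) x = x" "min u v \<le> x" "x \<le> max u v"
      using fixed_point_between by metis
    then have "x \<in> {c..d}" using uv(1,3) by auto
    have "(f ^^ d') x \<noteq> x" if d': "d' dvd n" "0 < d'" "d' < n" for d'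
    proof
      assume "(f ^^ d') x = x"
      then have fix_mult: "(f ^^ (d' * k)) x = x" for k by (rule periodic_funpow_mult)
      obtain k where "d' * k \<in> T" using T(4)[OF d'] by blast
      then have "x \<in> {b - h..b}"
        using cd(2) \<open>x \<in> {c..d}\<close> fix_mult by (metis image_subset_iff)
      then show False using \<open>x \<in> {c..d}\<close> cd(1) h by auto
    qed
    moreover have "0 < n" using \<open>s \<le> n\<close> s by simp
    ultimately have "\<forall>i. 0 < i \<and> i < n \<longrightarrow> (f ^^ i) x \<noteq> x"
      using least_period_of_avoiding[OF _ x(1)] by blast
    moreover have "x \<in> {a..b}" using \<open>x \<in> {c..d}\<close> cd(1) sub by blast
    ultimately show ?thesis
      using x(1) I \<open>0 < n\<close> unfolding period_points_def by blast
  qed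
  moreover have "16 * s ^ 3 + 8 * s > 0" using s by simp
  ultimately show ?thesis by blast
qed


section \<open>Invariant closed intervals and dense periodic points\<close>

text \<open>Stated for an arbitrary \<open>g\<close> because it is applied both to \<open>f\<close>
  and to \<open>f ^^ 2\<close>.\<close>

lemma transitive_imp_no_proper_invariant:
  assumes tr: "transitive_on I g"
  shows "\<not> has_proper_invariant_closed_interval I g"
proof
  assume "has_proper_invariant_closed_interval I g"
  then obtain J x y where J: "is_interval J" "closed J" "J \<subset> I" "g ` J \<subseteq> J"
    and xy: "x \<in> J" "y \<in> J" "x < y"
    unfolding has_proper_invariant_closed_interval_def nondeg_interval_def by blast
  have sub: "{x<..<y} \<subseteq> J"
    using mem_is_interval_1_I[OF J(1) xy(1,2)] by auto
  have "openin (top_of_set I) {x<..<y}" "{x<..<y} \<noteq> {}"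
    using sub J(3) xy(3) by (auto intro!: open_subset)
  moreover have "I - J = I \<inter> - J" by blast
  then have "openin (top_of_set I) (I - J)" "I - J \<noteq> {}"
    using J(2,3) by (auto simp: openin_open_Int open_Compl)
  ultimately obtain k where "(g ^^ k) ` {x<..<y} \<inter> (I - J) \<noteq> {}"
    using tr[unfolded transitive_on_def, rule_format, of "{x<..<y}" "I - J"] by blast
  then obtain w where w: "w \<in> J" "(g ^^ k) w \<notin> J" using sub by blast
  have "(g ^^ j) w \<in> J" for j
    by (induction j) (use w(1) J(4) in auto)
  then show False using w(2) by blast
qed

text \<open>The set \<open>Z\<close> may be disconnected. The image of its component through
  \<open>z\<close> is connected, stays in \<open>Z\<close> and contains the fixed point, so that
  component is invariant; \<open>W\<close> certifies that it is nondegenerate.\<close>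

lemma no_proper_invariant_imp_all:
  assumes no: "\<not> has_proper_invariant_closed_interval I f"
    and Z: "closed Z" "Z \<subseteq> I" "f ` Z \<subseteq> Z" and z: "f z = z"
    and W: "connected W" "z \<in> W" "W \<subseteq> Z" "x \<in> W" "y \<in> W" "x < y"
  shows "Z = I"
proof -
  define C where "C = connected_component_set Z z"
  have WC: "W \<subseteq> C"
    unfolding C_def using W by (intro connected_component_maximal)
  have "f ` C \<subseteq> C"
    unfolding C_def
  proof (rule connected_component_maximal)
    show "z \<in> f ` connected_component_set Z z"
      using WC W(2) z unfolding C_def by (metis image_eqI subsetD)
    have "connected_component_set Z z \<subseteq> I"
      using connected_component_subset Z(2) by (rule subset_trans)
    then show "connected (f ` connected_component_set Z z)"
      by (intro connected_continuous_image continuous_on_subset[OF cont]) auto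
    show "f ` connected_component_set Z z \<subseteq> Z"
      using connected_component_subset[of Z z] Z(3) by blast
  qed
  moreover have "closed C"
    unfolding C_def using Z(1) by (rule closed_connected_component)
  moreover have "is_interval C"
    unfolding C_def is_interval_connected_1 by (rule connected_connected_component)
  then have "nondeg_interval C"
    unfolding nondeg_interval_def using WC W(4-6) by blast
  moreover have CZ: "C \<subseteq> Z"
    unfolding C_def by (rule connected_component_subset)
  ultimately have "\<not> C \<subset> I"
    using no unfolding has_proper_invariant_closed_interval_def by blast
  then show ?thesis using CZ Z(2) by blast
qed

text \<open>On an unbounded \<open>I\<close> a fixed point does not come for free. A periodic orbit
  cannot move strictly in one direction all the way round, so both directions of weak displacement
  occur.\<close>

lemma fixed_point_of_periodic:
  assumes p: "p \<in> I" "0 < n" "(f ^^ n) p = p"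
  obtains z where "z \<in> I" "f z = z"
proof -
  obtain m where m: "n = Suc m" using p(2) by (cases n) auto
  have "\<exists>x\<in>I. f x \<le> x"
  proof (rule ccontr)
    assume no: "\<not> (\<exists>x\<in>I. f x \<le> x)"
    have "p \<le> (f ^^ j) p" for j
    proof (induction j)
      case (Suc j)
      then show ?case using no funpow_in[OF p(1), of j] by fastforce
    qed simp
    then have "p < f ((f ^^ m) p)"
      using no funpow_in[OF p(1), of m] by (meson le_less_trans not_le)
    then show False using p(3) m by simp
  qed
  then obtain x where x: "x \<in> I" "f x \<le> x" by blast
  have "\<exists>y\<in>I. y \<le> f y"
  proof (rule ccontr)
    assume no: "\<not> (\<exists>y\<in>I. y \<le> f y)"
    have "(f ^^ j) p \<le> p" for j
    proof (induction j)
      case (Suc j)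
      then show ?case using no funpow_in[OF p(1), of j] by fastforce
    qed simp
    then have "f ((f ^^ m) p) < p"
      using no funpow_in[OF p(1), of m] by (meson less_le_trans not_le)
    then show False using p(3) m by simp
  qed
  then obtain y where y: "y \<in> I" "y \<le> f y" by blast
  show ?thesis
    using fixed_point_between[of x y 1] x y that by auto
qed

text \<open>Closedness of \<open>I\<close> keeps the closure inside the set on which
  \<open>f\<close> is continuous.\<close>

lemma image_closure_in:
  assumes "closed I" "X \<subseteq> I" "f ` X \<subseteq> X"
  shows "closure X \<subseteq> I" "f ` closure X \<subseteq> closure X"
proof -
  show "closure X \<subseteq> I" using assms(1,2) by (intro closure_minimal)
  then show "f ` closure X \<subseteq> closure X"
    using assms(3) closure_subset
    by (intro image_closure_subset continuous_on_subset[OF cont]) auto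
qed

text \<open>Since periodic points are dense, the complement of a closed invariant set has an invariant
  closure as well. One of the two contains the fixed point in a nondegenerate component, and this
  component is invariant.\<close>
lemma dense_periodic_imp_transitive:
  assumes clI: "closed I" and dense_per: "dense_in I (\<Union>n. period_points I f n)"
    and no: "\<not> has_proper_invariant_closed_interval I f"
  shows "transitive_on I f"
proof (rule transitive_on_intervalI[OF nondeg])
  fix a b c d :: real
  assume ab: "a < b" "{a..b} \<subseteq> interior I" and cd: "c < d" "{c..d} \<subseteq> interior I"
  have per: "\<exists>p n. u < p \<and> p < v \<and> 0 < n \<and> (f ^^ n) p = p" if "u < v" "{u<..<v} \<subseteq> I" for u v
    using dense_per[unfolded dense_in_interval_iff[OF nondeg], THEN conjunct2, rule_format, of u v] that
    unfolding Union_period_points by auto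
  have abI: "{a<..<b} \<subseteq> I" and cdI: "{c<..<d} \<subseteq> I"
    using ab(2) cd(2) interior_subset[of I] by (auto simp: subset_iff)
  define X where "X = (\<Union>k. (f ^^ k) ` {a<..<b})"
  define Y where "Y = closure X"
  have XI: "X \<subseteq> I" unfolding X_def using funpow_image_in[OF abI] by blast
  have "f ` (f ^^ k) ` {a<..<b} = (f ^^ Suc k) ` {a<..<b}" for k
    by (simp add: image_comp)
  then have "f ` X \<subseteq> X" unfolding X_def by blast
  then have Y: "closed Y" "Y \<subseteq> I" "f ` Y \<subseteq> Y"
    unfolding Y_def using image_closure_in[OF clI XI] by auto
  have abX: "{a<..<b} \<subseteq> X" unfolding X_def using UN_upper[of 0 UNIV "\<lambda>k. (f ^^ k) ` {a<..<b}"] by simp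
  define e where "e = (a + b) / 2"
  have e: "a < e" "e < b" using ab(1) by (auto simp: e_def)
  obtain p n where p: "a < p" "p < e" "0 < n" "(f ^^ n) p = p"
    using per[OF e(1)] abI e by (auto simp: subset_iff)
  obtain q m where q: "e < q" "q < b" "0 < m" "(f ^^ m) q = q"
    using per[OF e(2)] abI e by (auto simp: subset_iff)
  have "p \<in> I" using abI p e by auto
  obtain z where z: "z \<in> I" "f z = z"
    using fixed_point_of_periodic[OF \<open>p \<in> I\<close> p(3,4)] .
  have "Y = I"
  proof (cases "z \<in> Y")
    case True
    \<comment> \<open>All images that make up \<open>D i\<close> contain \<open>(f ^^ i) p\<close>,
      because \<open>n\<close> is a period of \<open>p\<close>; hence \<open>D i\<close> is
      connected. There are finitely many residues, so the closure of one \<open>D i\<close> contains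
      \<open>z\<close>.\<close>
    define D where "D i = (\<Union>j. (f ^^ (i + n * j)) ` {a<..<b})" for i
    have "X \<subseteq> (\<Union>i\<in>{..<n}. D i)"
    proof
      fix x assume "x \<in> X"
      then obtain k where "x \<in> (f ^^ k) ` {a<..<b}" unfolding X_def by blast
      then have "x \<in> (f ^^ (k mod n + n * (k div n))) ` {a<..<b}" by simp
      then have "x \<in> D (k mod n)" unfolding D_def by blast
      then show "x \<in> (\<Union>i\<in>{..<n}. D i)" using p(3) by auto
    qed
    then have "X \<subseteq> (\<Union>i\<in>{..<n}. closure (D i))" using closure_subset by blast
    then have "Y \<subseteq> (\<Union>i\<in>{..<n}. closure (D i))"
      unfolding Y_def by (rule closure_minimal) (intro closed_UN finite_lessThan ballI closed_closure)
    then obtain i where i: "z \<in> closure (D i)" using True by blast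
    have pD: "(f ^^ i) p \<in> (f ^^ (i + n * j)) ` {a<..<b}" for j
    proof
      show "(f ^^ i) p = (f ^^ (i + n * j)) p"
        using periodic_funpow_mult[OF p(4), of j] by (simp add: funpow_add)
    qed (use p e in auto)
    have "connected ((f ^^ (i + n * j)) ` {a<..<b})" for j
      by (intro connected_continuous_image continuous_on_subset[OF continuous_on_funpow abI]) auto
    moreover have "(f ^^ i) p \<in> (\<Inter>j. (f ^^ (i + n * j)) ` {a<..<b})" using pD by blast
    ultimately have "connected (D i)"
      unfolding D_def by (intro connected_Union) blast+
    then have conn: "connected (closure (D i))" by (rule connected_imp_connected_closure)
    have "D i \<subseteq> X" unfolding D_def X_def by blast
    then have sub: "closure (D i) \<subseteq> Y" unfolding Y_def by (rule closure_mono)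
    have "(f ^^ (i + n * 0)) ` {a<..<b} \<subseteq> D i" unfolding D_def by (rule UN_upper) simp
    then have pq: "(f ^^ i) p \<in> closure (D i)" "(f ^^ i) q \<in> closure (D i)"
      using p q e closure_subset[of "D i"] by (auto simp: subset_iff)
    \<comment> \<open>These two points make the connected set nondegenerate. Their order is unknown,
      so the component lemma is invoked for both orders.\<close>
    have "(f ^^ i) p \<noteq> (f ^^ i) q"
    proof
      assume "(f ^^ i) p = (f ^^ i) q"
      moreover have "(f ^^ (n * m)) p = p" "(f ^^ (n * m)) q = q"
        using periodic_funpow_mult[OF p(4), of m] periodic_funpow_mult[OF q(4), of n]
        by (simp_all add: mult.commute)
      ultimately have "p = q"
        using periodic_funpow_inj[of "n * m" f p q i] p(3) q(3) by simp
      then show False using p q by simp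
    qed
    then show ?thesis
      using no_proper_invariant_imp_all[OF no Y z(2) conn i sub pq]
        no_proper_invariant_imp_all[OF no Y z(2) conn i sub pq(2,1)] by linarith
  next
    case False
    \<comment> \<open>The complement of \<open>Y\<close> itself may be mapped into \<open>Y\<close>.
      Its periodic points are not: an orbit that enters \<open>Y\<close> stays there and could not
      return to its starting point.\<close>
    define P where "P = {x \<in> I - Y. \<exists>n>0. (f ^^ n) x = x}"
    define Z where "Z = closure P"
    have "f ` P \<subseteq> P"
    proof
      fix y assume "y \<in> f ` P"
      then obtain x k where x: "y = f x" "x \<in> I" "x \<notin> Y" "0 < k" "(f ^^ k) x = x"
        unfolding P_def by blast
      obtain l where l: "k = Suc l" using x(4) by (cases k) auto
      have "(f ^^ j) y \<in> Y" if "y \<in> Y" for j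
        by (induction j) (use that Y(3) in auto)
      moreover have "(f ^^ l) y = x"
        using x(1,5) l by (simp add: funpow_swap1)
      ultimately have "y \<notin> Y" using x(3) by metis
      moreover have "(f ^^ k) y = y"
        using x(1,5) by (metis funpow_swap1)
      ultimately show "y \<in> P" unfolding P_def using x f_in by auto
    qed
    moreover have "P \<subseteq> I" unfolding P_def by blast
    ultimately have Z: "closed Z" "Z \<subseteq> I" "f ` Z \<subseteq> Z"
      unfolding Z_def using image_closure_in[OF clI] by auto
    obtain T where "open T" "z \<in> T" "T \<inter> Y = {}"
      using False Y(1) by (metis Compl_disjoint2 ComplI open_Compl)
    then obtain r where r: "0 < r" "{z - r..z + r} \<inter> Y = {}"
      using open_contains_cball[of T] by (auto simp: cball_eq_atLeastAtMost) blast
    \<comment> \<open>A window around \<open>z\<close> that avoids \<open>Y\<close>. The fixed point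
      may be an endpoint of \<open>I\<close>, so the window may be one-sided.\<close>
    define W where "W = I \<inter> {z - r..z + r}"
    have W: "connected W" "z \<in> W"
      unfolding W_def using r(1) z(1) is_interval_Int[OF ivl_I is_interval_cc]
      by (auto simp: is_interval_connected_1)
    have "W \<subseteq> closure (interior W)"
    proof -
      obtain x where x: "x \<in> I" "x \<noteq> z" using nondeg unfolding nondeg_interval_def by blast
      have "nondeg_interval W"
      proof (cases "z < x")
        case True
        then have "{z..x} \<subseteq> I" using closed_segment_in z(1) x(1) by blast
        then have "min x (z + r) \<in> W" unfolding W_def using True r(1) by auto
        moreover have "z < min x (z + r)" using True r(1) by auto
        ultimately show ?thesis
          using W unfolding nondeg_interval_def is_interval_connected_1 by blast
      next
        case False
        then have "{x..z} \<subseteq> I" using closed_segment_in z(1) x(1) by blast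
        then have "max x (z - r) \<in> W" unfolding W_def using False x(2) r(1) by auto
        moreover have "max x (z - r) < z" using False x(2) r(1) by auto
        ultimately show ?thesis
          using W unfolding nondeg_interval_def is_interval_connected_1 by blast
      qed
      then show ?thesis using nondeg_interval_closure_interior closure_subset by metis
    qed
    then have "interior W \<noteq> {}" using W(2) by auto
    then obtain w where "w \<in> interior W" by blast
    then obtain x y where xy: "x < w" "w < y" "{x..y} \<subseteq> interior W"
      using open_real_contains_interval open_interior by metis
    have "interior W \<subseteq> Z"
    proof
      fix t assume t: "t \<in> interior W"
      show "t \<in> Z"
        unfolding Z_def closure_iff_nhds_not_empty
      proof (intro allI impI)
        fix A V assume V: "V \<subseteq> A" "open V" "t \<in> V"
        obtain u v where uv: "u < t" "t < v" "{u..v} \<subseteq> V \<inter> interior W"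
          using open_real_contains_interval[OF open_Int[OF V(2) open_interior] IntI[OF V(3) t]] .
        have "{u..v} \<subseteq> W" using uv(3) interior_subset by blast
        then have "{u..v} \<subseteq> I" and uvY: "{u..v} \<inter> Y = {}" unfolding W_def using r(2) by blast+
        then have uvI: "{u<..<v} \<subseteq> I" by (auto simp: subset_iff)
        then obtain p' k where p': "u < p'" "p' < v" "0 < k" "(f ^^ k) p' = p'"
          using per[of u v] uv by auto
        then have "p' \<in> {u..v}" "p' \<in> {u<..<v}" by auto
        then have "p' \<in> I" "p' \<notin> Y" "p' \<in> A" using uvI uvY uv(3) V(1) by blast+
        then have "p' \<in> P" "p' \<in> A" unfolding P_def using p'(3,4) by auto
        then show "P \<inter> A \<noteq> {}" by blast
      qed
    qed
    then have "closure (interior W) \<subseteq> Z" using Z(1) by (rule closure_minimal)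
    then have WZ: "W \<subseteq> Z" using \<open>W \<subseteq> closure (interior W)\<close> by blast
    have "x \<in> W" "y \<in> W" "x < y" using xy subset_trans[OF xy(3) interior_subset] by (auto simp: subset_iff)
    then have "Z = I" by (rule no_proper_invariant_imp_all[OF no Z z(2) W WZ])
    moreover have "P \<inter> {a<..<b} = {}"
      unfolding P_def using abX closure_subset[of X] unfolding Y_def by blast
    then have "Z \<inter> {a<..<b} = {}"
      unfolding Z_def by (metis inf_commute open_Int_closure_eq_empty open_greaterThanLessThan)
    moreover have "e \<in> {a<..<b}" using e by simp
    ultimately show ?thesis using abI by blast
  qed
  then have "dense_in I X"
    unfolding dense_in_def Y_def using XI by simp
  then have "X \<inter> {c<..<d} \<noteq> {}"
    using cd(1) cdI unfolding dense_in_interval_iff[OF nondeg] by simp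
  then obtain y where "y \<in> X" "y \<in> {c<..<d}" by blast
  then obtain k x where x: "x \<in> {a<..<b}" "(f ^^ k) x \<in> {c<..<d}"
    unfolding X_def by blast
  \<comment> \<open>\<open>k\<close> may be zero, while transitivity asks for a positive time. A
    periodic point in \<open>?V\<close> still arrives when its period \<open>l\<close> is
    added.\<close>
  let ?V = "{a<..<b} \<inter> (I \<inter> (f ^^ k) -` {c<..<d})"
  have "openin (top_of_set I) ?V"
    by (rule openin_Int[OF open_subset[OF abI open_greaterThanLessThan]
        continuous_openin_preimage_gen[OF continuous_on_funpow open_greaterThanLessThan]])
  moreover have "?V \<noteq> {}" using x abI by blast
  ultimately obtain u v where uv: "u < v" "{u..v} \<subseteq> ?V"
    using openin_interval_contains_interval[OF nondeg] by metis
  then have "{u<..<v} \<subseteq> I" by (auto simp: subset_iff)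
  then obtain p' l where p': "u < p'" "p' < v" "0 < l" "(f ^^ l) p' = p'"
    using per[OF uv(1)] by auto
  then have "p' \<in> ?V" using uv(2) by (auto simp: subset_iff)
  moreover have "(f ^^ (k + l)) p' = (f ^^ k) p'" using p'(4) by (simp add: funpow_add)
  ultimately have "p' \<in> {a..b}" "(f ^^ (k + l)) p' \<in> {c..d}" by auto
  then show "\<exists>k>0. \<exists>x\<in>{a..b}. (f ^^ k) x \<in> {c..d}"
    using p'(3) by (intro exI[of _ "k + l"]) auto
qed

section \<open>The equivalent conditions on periods and invariant intervals\<close>

lemma covers_imp_all_large_periods:
  assumes cov: "eventually_covers_compact_intervals I f" and tr: "transitive_on I f"
  shows "all_large_periods_everywhere I f"
  unfolding all_large_periods_everywhere_def
proof (intro conjI allI impI)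
  show "\<not> has_proper_invariant_closed_interval I f"
    using tr by (rule transitive_imp_no_proper_invariant)
  fix U assume U: "nondeg_interval U \<and> open U \<and> U \<subseteq> I"
  then obtain x where "x \<in> U" unfolding nondeg_interval_def by blast
  then obtain a b where ab: "a < x" "x < b" "{a..b} \<subseteq> U"
    using open_real_contains_interval U by blast
  have "U \<subseteq> interior I" using U by (simp add: interior_maximal)
  then have "{a..b} \<subseteq> interior I" using ab(3) by (rule order_trans[rotated])
  moreover have "a < b" using ab by simp
  ultimately obtain m where "m > 0" "\<And>n. n \<ge> m \<Longrightarrow> period_points I f n \<inter> {a..b} \<noteq> {}"
    using covers_imp_period_points[OF cov] by metis
  then show "\<exists>m>0. \<forall>n\<ge>m. period_points I f n \<inter> U \<noteq> {}"
    using ab(3) by blast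
qed

lemma all_large_periods_imp_dense_periods_with_odd:
  assumes "all_large_periods_everywhere I f"
  shows "dense_periods_with_odd I f"
proof -
  have per: "\<exists>m>0. \<forall>n\<ge>m. period_points I f n \<inter> {a<..<b} \<noteq> {}" if "a < b" "{a<..<b} \<subseteq> I" for a b
  proof -
    have "nondeg_interval {a<..<b}"
      unfolding nondeg_interval_def
      using that(1) by (intro conjI bexI[of _ "(2 * a + b) / 3"] bexI[of _ "(a + 2 * b) / 3"])
        (auto simp: is_interval_oo)
    then show ?thesis
      using assms[unfolded all_large_periods_everywhere_def, THEN conjunct1, rule_format,
          of "{a<..<b}"] that(2) by simp
  qed
  obtain a b where ab: "a < b" "{a..b} \<subseteq> interior I" using interior_I_interval .
  then have "{a<..<b} \<subseteq> I" using interior_subset[of I] by (auto simp: subset_iff)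
  then obtain m where m: "m > 0" "\<forall>n\<ge>m. period_points I f n \<inter> {a<..<b} \<noteq> {}"
    using per[OF ab(1)] by blast
  show ?thesis
    unfolding dense_periods_with_odd_def
  \<comment> \<open>\<open>m\<close> comes from one fixed interval, which makes every member a
    period that occurs. Density in other intervals may have to use larger members.\<close>
  proof (intro conjI exI[of _ "{m..}"])
    show "\<exists>q\<in>{m..}. odd q \<and> 3 \<le> q"
      by (intro bexI[of _ "2 * m + 3"]) auto
    show "\<forall>n\<in>{m..}. period_points I f n \<noteq> {}" using m(2) by auto
    show "\<not> has_proper_invariant_closed_interval I f"
      using assms unfolding all_large_periods_everywhere_def by blast
    show "dense_in I (\<Union>n\<in>{m..}. period_points I f n)"
      unfolding dense_in_interval_iff[OF nondeg]
    proof (intro conjI allI impI)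
      show "(\<Union>n\<in>{m..}. period_points I f n) \<subseteq> I" unfolding period_points_def by blast
      fix a b :: real assume ab: "a < b \<and> {a<..<b} \<subseteq> I"
      then obtain m' where "\<forall>n\<ge>m'. period_points I f n \<inter> {a<..<b} \<noteq> {}"
        using per[of a b] by blast
      then have "period_points I f (m + m') \<inter> {a<..<b} \<noteq> {}" by simp
      moreover have "period_points I f (m + m') \<subseteq> (\<Union>n\<in>{m..}. period_points I f n)"
        by (rule UN_upper) simp
      ultimately show "(\<Union>n\<in>{m..}. period_points I f n) \<inter> {a<..<b} \<noteq> {}" by blast
    qed
  qed (use m(1) infinite_Ici in auto)
qed

text \<open>If \<open>f\<close> exchanges the sides of \<open>z\<close>, an odd iterate can fix only
  \<open>z\<close>, which has least period one; this is incompatible with an occurring odd period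
  \<open>q \<ge> 3\<close>.\<close>

lemma dense_periods_with_odd_imp_same_side:
  assumes clI: "closed I" and "dense_periods_with_odd I f"
  shows "transitive_with_same_side_point I f"
proof (rule ccontr)
  assume noss: "\<not> transitive_with_same_side_point I f"
  obtain N q where N: "dense_in I (\<Union>n\<in>N. period_points I f n)"
      "\<not> has_proper_invariant_closed_interval I f"
    and q: "odd q" "3 \<le> q" "period_points I f q \<noteq> {}"
    using assms(2) unfolding dense_periods_with_odd_def by blast
  have "(\<Union>n\<in>N. period_points I f n) \<subseteq> (\<Union>n. period_points I f n)" by blast
  then have "closure (\<Union>n\<in>N. period_points I f n) \<subseteq> closure (\<Union>n. period_points I f n)"
    by (rule closure_mono)
  moreover have "(\<Union>n. period_points I f n) \<subseteq> I" unfolding Union_period_points by blast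
  ultimately have "dense_in I (\<Union>n. period_points I f n)"
    using N(1) unfolding dense_in_def by blast
  then have "transitive_on I f"
    using dense_periodic_imp_transitive[OF clI _ N(2)] by blast
  then obtain z where z: "z \<in> interior I" "f z = z" and
    swap: "\<forall>x\<in>I. (x \<le> z \<longrightarrow> z \<le> f x) \<and> (z \<le> x \<longrightarrow> f x \<le> z)"
    by (rule not_same_side_swap[OF _ noss])
  obtain x where "x \<in> period_points I f q" using q(3) by blast
  then have x: "x \<in> I" "(f ^^ q) x = x" and "\<forall>i. 0 < i \<and> i < q \<longrightarrow> (f ^^ i) x \<noteq> x"
    unfolding period_points_def by auto
  then have "f x \<noteq> x" using q(2) by (auto dest: spec[of _ 1])
  have "x = z"
    using swap_funpow(2)[OF swap x(1) _ q(1)] swap_funpow(4)[OF swap x(1) _ q(1)] x(2)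
    by (cases "x \<le> z") auto
  then show False using \<open>f x \<noteq> x\<close> z(2) by simp
qed

lemma same_side_imp_dense_periodic_square_irreducible:
  assumes tr: "transitive_on I f" and "totally_transitive_on I f"
  shows "dense_periodic_square_irreducible I f"
  unfolding dense_periodic_square_irreducible_def
proof
  show "\<not> has_proper_invariant_closed_interval I (f ^^ 2)"
    using assms(2) unfolding totally_transitive_on_def
    by (intro transitive_imp_no_proper_invariant) simp
  show "dense_in I (\<Union>n. period_points I f n)"
    unfolding dense_in_interval_iff[OF nondeg] Union_period_points
  proof (intro conjI allI impI)
    fix a b :: real assume ab: "a < b \<and> {a<..<b} \<subseteq> I"
    then obtain p n where "p \<in> {a<..<b}" "n > 0" "(f ^^ n) p = p"
      using periodic_point_in_interval[OF tr] by metis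
    then show "{x \<in> I. \<exists>n>0. (f ^^ n) x = x} \<inter> {a<..<b} \<noteq> {}"
      using ab by blast
  qed blast
qed

lemma dense_periodic_square_irreducible_imp_same_side:
  assumes clI: "closed I" and "dense_periodic_square_irreducible I f"
  shows "transitive_with_same_side_point I f"
proof (rule ccontr)
  assume noss: "\<not> transitive_with_same_side_point I f"
  have dense: "dense_in I (\<Union>n. period_points I f n)"
    and no2: "\<not> has_proper_invariant_closed_interval I (f ^^ 2)"
    using assms(2) unfolding dense_periodic_square_irreducible_def by auto
  have "\<not> has_proper_invariant_closed_interval I f"
  proof
    assume "has_proper_invariant_closed_interval I f"
    then obtain J where J: "nondeg_interval J" "closed J" "J \<subset> I" "f ` J \<subseteq> J"
      unfolding has_proper_invariant_closed_interval_def by blast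
    have "(f ^^ 2) ` J \<subseteq> J"
      using J(4) by (auto simp: numeral_2_eq_2)
    then show False
      using no2 J(1-3) unfolding has_proper_invariant_closed_interval_def by blast
  qed
  then have "transitive_on I f"
    using dense_periodic_imp_transitive[OF clI dense] by blast
  then obtain z where z: "z \<in> interior I" "f z = z" and
    swap: "\<forall>x\<in>I. (x \<le> z \<longrightarrow> z \<le> f x) \<and> (z \<le> x \<longrightarrow> f x \<le> z)"
    by (rule not_same_side_swap[OF _ noss])
  obtain a b where ab: "a < z" "z < b" "{a..b} \<subseteq> I" using interiorE[OF z(1)] .
  \<comment> \<open>The two sides are exchanged by \<open>f\<close>, hence each is preserved by
    \<open>f ^^ 2\<close>; the left one is a closed proper subinterval of \<open>I\<close>.\<close>
  let ?J = "I \<inter> {..z}"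
  have mem: "a \<in> ?J" "z \<in> ?J" "b \<in> I - ?J" using ab by auto
  have "is_interval ?J" using is_interval_Int[OF ivl_I] by (simp add: is_interval_ic)
  then have "nondeg_interval ?J" unfolding nondeg_interval_def using mem ab(1) by blast
  moreover have "closed ?J" using clI by (intro closed_Int) auto
  moreover have "?J \<subset> I" using mem(3) by blast
  moreover have "(f ^^ 2) ` ?J \<subseteq> ?J"
    using funpow_in swap_funpow(1)[OF swap, of _ 2] by auto
  ultimately show False
    using no2 unfolding has_proper_invariant_closed_interval_def by blast
qed

end

section \<open>Assembly of the equivalences, with the same-side condition as the hub\<close>

theorem theorem6:
  fixes I :: "real set" and f :: "real \<Rightarrow> real"
  assumes "nondeg_interval I"
    and "continuous_on I f"
    and "f ` I \<subseteq> I"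
  shows "(transitive_with_same_side_point I f \<longleftrightarrow> eventually_covers_compact_intervals I f) \<and>
    (eventually_covers_compact_intervals I f \<longrightarrow> simultaneous_covering I f) \<and>
    (transitive_with_same_side_point I f \<longleftrightarrow> mixing_on I f) \<and>
    (transitive_with_same_side_point I f \<longleftrightarrow> weakly_mixing_on I f) \<and>
    (transitive_with_same_side_point I f \<longleftrightarrow> residual_dense_along_every_subsequence I f) \<and>
    (transitive_with_same_side_point I f \<longleftrightarrow> even_iterate_transitive I f) \<and>
    (transitive_with_same_side_point I f \<longleftrightarrow> totally_transitive_on I f) \<and>
    (closed I \<longrightarrow>
      (transitive_with_same_side_point I f \<longleftrightarrow> all_large_periods_everywhere I f) \<and>
      (transitive_with_same_side_point I f \<longleftrightarrow> dense_periods_with_odd I f) \<and>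
      (transitive_with_same_side_point I f \<longleftrightarrow> dense_periodic_square_irreducible I f))"
proof -
  interpret interval_map I f
    using assms by unfold_locales
  have tr: "transitive_with_same_side_point I f \<Longrightarrow> transitive_on I f"
    unfolding transitive_with_same_side_point_def by blast
  show ?thesis
    using same_side_imp_eventually_covers covers_imp_simultaneous covers_imp_mixing
      mixing_imp_weakly_mixing weakly_mixing_imp_same_side
      mixing_imp_residual residual_imp_same_side
      mixing_imp_totally_transitive totally_transitive_imp_even_iterate even_iterate_imp_same_side
      covers_imp_all_large_periods[OF _ tr] all_large_periods_imp_dense_periods_with_odd
      dense_periods_with_odd_imp_same_side
      same_side_imp_dense_periodic_square_irreducible[OF tr]
      dense_periodic_square_irreducible_imp_same_side
    by blast
qed

end
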